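(* A discrete-time filter that gives a second order numerical integrator for the continuous-time filter $$\dot{\hat R}=\hat R\hat\Omega^\times,\qquad m\dot\omega=-m\hat\Omega\times\omega+\Phi'\big(\mathcal U^0(\hat R,U^m)\big)S_L(\hat R)-D\omega,\qquad \hat\Omega=\Omega^m-\omega$$ is given as follows: $$\hat R_{i+1}=\hat R_i\exp\big(h(\Omega^m_{i+\frac12}-\omega_{i+\frac12})^\times\big),$$ $$m\omega_{i+1}=\exp\big(-\tfrac h2\hat\Omega_{i+1}^\times\big)\Big\{\big(mI_{3\times3}-\tfrac h2D\big)\omega_{i+\frac12}+\tfrac h2\Phi'\big(\mathcal U^0(\hat R_{i+1},U^m_{i+1})\big)S_{L_{i+1}}(\hat R_{i+1})\Big\},$$ $$\hat\Omega_i=\Omega^m_i-\omega_i,\qquad \Omega^m_{i+\frac12}=\tfrac12(\Omega^m_i+\Omega^m_{i+1}),$$ where $$\omega_{i+\frac12}=\big(mI_{3\times3}+\tfrac h2D\big)^{-1}\Big\{\exp\big(-\tfrac h2\hat\Omega_i^\times\big)m\omega_i+\tfrac h2\Phi'\big(\mathcal U^0(\hat R_i,U^m_i)\big)S_{L_i}(\hat R_i)\Big\}$$ is a discrete-time approximation to the angular velocity at time $t_{i+\frac12}:=t_i+\frac h2$.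
   Context: $a^\times$ is the skew-symmetric matrix with $a^\times c=a\times c$; $\mathrm{vex}$ is the inverse of $a\mapsto a^\times$; $\langle A_1,A_2\rangle=\mathrm{trace}(A_1^TA_2)$. $S_L(\hat R)=\mathrm{vex}(L^T\hat R-\hat R^TL)$ with $L=EW(U^m)^T$, and $S_{L_i}(\hat R_i)=\mathrm{vex}(L_i^T\hat R_i-\hat R_i^TL_i)$ with $L_i=E_iW_i(U^m_i)^T$. $E$ (rank 3, $3\times n$) is the matrix of known inertial vectors, $U^m$ the matrix of the same vectors measured in the body frame (when exactly two vectors are measured, their cross product is used as a third column), $W$ a positive definite weight matrix chosen such that $EWE^T=U_E\,\mathrm{diag}(d_1,d_2,d_3)\,U_E^T$ with $d_1,d_2,d_3>0$ and $U_E$ the orthogonal matrix of left singular vectors of $E$, $\Omega^m$ the measured angular velocity; $\hat R\in SO(3)$, $\hat\Omega\in\mathbb R^3$ are the estimated attitude and angular velocity, and $\omega=\Omega^m-\hat\Omega$ is the angular velocity estimate error. $m>0$ is a scalar, $D\in\mathbb R^{3\times3}$ is positive definite. $\mathcal U^0(\hat R,U^m)=\frac12\langle E-\hat RU^m,(E-\hat RU^m)W\rangle$. $\Phi:[0,\infty)\to[0,\infty)$ is a $C^2$ function with $\Phi(0)=0$ and $\Phi'(x)>0$ for all $x\in[0,\infty)$; furthermore $\Phi'(\cdot)\le\alpha(\cdot)$ where $\alpha(\cdot)$ is a Class-$\mathcal K$ function. The interval $[t_0,T]$ is divided into $N$ subintervals $[t_i,t_{i+1}]$ of length $h$; a subscript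 $i$ denotes the value at $t_i$ (for estimates: the discrete approximation to the exact continuous-time filter solution at $t_i$).
   Formalization: The conditions Φ'(x)>0 for all x≥0 and Φ'≤α with α of Class-K contradict each other at x=0 (α(0)=0); here Φ'(x)>0 is required for x>0, together with either Φ'(0)>0 or Φ'≤α; second order is meant along C³ filter solutions with continuous E, W, U^m, Ω^m. *)

theory Defs
  imports "HOL-Analysis.Analysis"
begin

section \<open>Matrices\<close>

definition skew :: "real^3 \<Rightarrow> real^3^3" where
  "skew a = matrix (cross3 a)"

text \<open>Only meaningful on skew-symmetric matrices, which form the range of \<open>skew\<close>.\<close>

definition vex :: "real^3^3 \<Rightarrow> real^3" where
  "vex = inv skew"

definition mat_inner :: "real^'n^'m \<Rightarrow> real^'n^'m \<Rightarrow> real" where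
  "mat_inner A B = trace (transpose A ** B)"

text \<open>Matrices do not form an instance of the normed-algebra classes, so the library's \<open>exp\<close>
  does not apply to them.\<close>

definition mat_exp :: "real^'n^'n \<Rightarrow> real^'n^'n" where
  "mat_exp A = (\<Sum>k. (1 / fact k) *\<^sub>R (((\<lambda>B. A ** B) ^^ k) (mat 1)))"

definition diag_mat :: "real^'n \<Rightarrow> real^'n^'n" where
  "diag_mat d = (\<chi> i j. if i = j then d $ i else 0)"

definition positive_definite :: "real^'n^'n \<Rightarrow> bool" where
  "positive_definite A \<longleftrightarrow> transpose A = A \<and> (\<forall>x. x \<noteq> 0 \<longrightarrow> x \<bullet> (A *v x) > 0)"

text \<open>The thin singular value decomposition \<open>E = Q S V\<^sup>T\<close>: only the three right singular vectors
  that enter the product are kept, as the orthonormal columns of \<open>V\<close>.\<close>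

definition left_singular_matrix :: "real^'n^3 \<Rightarrow> real^3^3 \<Rightarrow> bool" where
  "left_singular_matrix E Q \<longleftrightarrow> orthogonal_matrix Q \<and>
     (\<exists>s (V :: real^3^'n). (\<forall>k. s $ k \<ge> 0) \<and> transpose V ** V = mat 1 \<and>
        E = Q ** diag_mat s ** transpose V)"

definition adapted_weight :: "real^'n^3 \<Rightarrow> real^'n^'n \<Rightarrow> bool" where
  "adapted_weight E W \<longleftrightarrow> positive_definite W \<and>
     (\<exists>Q d. left_singular_matrix E Q \<and> (\<forall>k. d $ k > 0) \<and>
        E ** W ** transpose E = Q ** diag_mat d ** transpose Q)"


section \<open>The gain function\<close>

text \<open>On a set with boundary the derivatives are one-sided.\<close>

primrec Cn_on :: "nat \<Rightarrow> (real \<Rightarrow> 'a::real_normed_vector) \<Rightarrow> real set \<Rightarrow> bool" where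
  "Cn_on 0 f S \<longleftrightarrow> continuous_on S f"
| "Cn_on (Suc n) f S \<longleftrightarrow>
     (\<exists>f'. (\<forall>x\<in>S. (f has_vector_derivative f' x) (at x within S)) \<and> Cn_on n f' S)"

definition class_K :: "(real \<Rightarrow> real) \<Rightarrow> bool" where
  "class_K \<alpha> \<longleftrightarrow> continuous_on {0..} \<alpha> \<and> strict_mono_on {0..} \<alpha> \<and> \<alpha> 0 = 0"

text \<open>\<open>\<phi>\<close> is the derivative of \<open>\<Phi>\<close> on the half-line. The two requirements usually imposed,
  \<open>\<phi> > 0\<close> on \<open>[0,\<infinity>)\<close> and \<open>\<phi> \<le> \<alpha>\<close> with \<open>\<alpha>\<close> of class K, exclude each other at \<open>0\<close>, since
  \<open>\<alpha> 0 = 0\<close>. Here \<open>\<phi> > 0\<close> is required on \<open>(0,\<infinity>)\<close>, and at \<open>0\<close> one of the two suffices. This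
  is implied by their conjunction and admits both \<open>\<Phi> x = x\<close> and \<open>\<Phi> x = x\<^sup>2\<close>.\<close>

definition gain_function :: "(real \<Rightarrow> real) \<Rightarrow> (real \<Rightarrow> real) \<Rightarrow> bool" where
  "gain_function \<Phi> \<phi> \<longleftrightarrow>
     (\<forall>x\<ge>0. \<Phi> x \<ge> 0) \<and> \<Phi> 0 = 0 \<and> Cn_on 2 \<Phi> {0..} \<and>
     (\<forall>x\<ge>0. (\<Phi> has_real_derivative \<phi> x) (at x within {0..})) \<and>
     (\<forall>x>0. \<phi> x > 0) \<and>
     (\<phi> 0 > 0 \<or> (\<exists>\<alpha>. class_K \<alpha> \<and> (\<forall>x\<ge>0. \<phi> x \<le> \<alpha> x)))"


section \<open>Order of a one-step integrator\<close>

text \<open>A one-step method is a relation \<open>step t h y y'\<close>, because the update may be implicit.\<close>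

definition discrete_solution ::
  "(real \<Rightarrow> real \<Rightarrow> 's \<Rightarrow> 's \<Rightarrow> bool) \<Rightarrow> real \<Rightarrow> real \<Rightarrow> nat \<Rightarrow> 's \<Rightarrow> (nat \<Rightarrow> 's) \<Rightarrow> bool" where
  "discrete_solution step t\<^sub>0 h N y\<^sub>0 ys \<longleftrightarrow>
     ys 0 = y\<^sub>0 \<and> (\<forall>i<N. step (t\<^sub>0 + real i * h) h (ys i) (ys (Suc i)))"

text \<open>The usual notion of order \<open>p\<close>. Along every sufficiently smooth (\<open>C\<^bsup>p+1\<^esup>\<close>) exact solution on
  \<open>[t\<^sub>0, T]\<close> and for all small enough step sizes, the method can be carried out, its error after one
  step from exact data is \<open>O(h\<^bsup>p+1\<^esup>)\<close>, and its error on the whole grid is \<open>O(h\<^bsup>p\<^esup>)\<close>. For an implicit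
  method the bounds are required of every solution of the step equations. The predicate \<open>sol\<close>
  singles out the exact solutions of the differential equation.\<close>

definition integrator_of_order ::
  "nat \<Rightarrow> ((real \<Rightarrow> 's::real_normed_vector) \<Rightarrow> bool) \<Rightarrow>
   (real \<Rightarrow> real \<Rightarrow> 's \<Rightarrow> 's \<Rightarrow> bool) \<Rightarrow> real \<Rightarrow> real \<Rightarrow> bool" where
  "integrator_of_order p sol step t\<^sub>0 T \<longleftrightarrow>
     (\<forall>y. sol y \<and> Cn_on (p + 1) y {t\<^sub>0..T} \<longrightarrow>
       (\<exists>K h\<^sub>0. h\<^sub>0 > 0 \<and>
         (\<forall>t h. t\<^sub>0 \<le> t \<and> t + h \<le> T \<and> 0 < h \<and> h \<le> h\<^sub>0 \<longrightarrow>
            (\<exists>y'. step t h (y t) y') \<and>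
            (\<forall>y'. step t h (y t) y' \<longrightarrow> norm (y' - y (t + h)) \<le> K * h ^ (p + 1))) \<and>
         (\<forall>N h. N > 0 \<and> h = (T - t\<^sub>0) / real N \<and> h \<le> h\<^sub>0 \<longrightarrow>
            (\<exists>ys. discrete_solution step t\<^sub>0 h N (y t\<^sub>0) ys) \<and>
            (\<forall>ys. discrete_solution step t\<^sub>0 h N (y t\<^sub>0) ys \<longrightarrow>
               (\<forall>i\<le>N. norm (ys i - y (t\<^sub>0 + real i * h)) \<le> K * h ^ p)))))"


section \<open>The filter\<close>

text \<open>The known vectors \<open>E\<close>, their weights \<open>W\<close>, the body-frame vector measurements \<open>U\<close> and the
  angular velocity measurement \<open>\<Omega>\<close> are functions of time, sampled at the grid points by the
  discrete filter. If only two vectors are measured, \<open>E\<close> and \<open>U\<close> have their cross products as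
  third columns. The state is the pair of the attitude estimate \<open>R\<close> and the angular velocity
  estimation error \<open>\<omega>\<close>; the angular velocity estimate is \<open>\<Omega> t - \<omega>\<close>.\<close>

definition potential :: "real^'n^3 \<Rightarrow> real^'n^'n \<Rightarrow> real^3^3 \<Rightarrow> real^'n^3 \<Rightarrow> real" where
  "potential E W R U = 1 / 2 * mat_inner (E - R ** U) ((E - R ** U) ** W)"

definition innovation :: "real^3^3 \<Rightarrow> real^3^3 \<Rightarrow> real^3" where
  "innovation L R = vex (transpose L ** R - transpose R ** L)"

text \<open>The term \<open>\<Phi>'(\<U>\<^sup>0(R, U)) S\<^sub>L(R)\<close> at time \<open>t\<close>, where \<open>L = E W U\<^sup>T\<close>.\<close>

definition feedback ::
  "(real \<Rightarrow> real) \<Rightarrow> (real \<Rightarrow> real^'n^3) \<Rightarrow> (real \<Rightarrow> real^'n^'n) \<Rightarrow> (real \<Rightarrow> real^'n^3) \<Rightarrow>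
   real \<Rightarrow> real^3^3 \<Rightarrow> real^3" where
  "feedback \<phi> E W U t R =
     \<phi> (potential (E t) (W t) R (U t)) *\<^sub>R innovation (E t ** W t ** transpose (U t)) R"

definition filter_solution ::
  "real \<Rightarrow> real^3^3 \<Rightarrow> (real \<Rightarrow> real) \<Rightarrow>
   (real \<Rightarrow> real^'n^3) \<Rightarrow> (real \<Rightarrow> real^'n^'n) \<Rightarrow> (real \<Rightarrow> real^'n^3) \<Rightarrow> (real \<Rightarrow> real^3) \<Rightarrow>
   real \<Rightarrow> real \<Rightarrow> (real \<Rightarrow> (real^3^3) \<times> (real^3)) \<Rightarrow> bool" where
  "filter_solution m D \<phi> E W U \<Omega> t\<^sub>0 T y \<longleftrightarrow>
     (\<exists>R \<omega> \<omega>'. y = (\<lambda>t. (R t, \<omega> t)) \<and>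
       (\<forall>t\<in>{t\<^sub>0..T}.
          rotation_matrix (R t) \<and>
          (R has_vector_derivative R t ** skew (\<Omega> t - \<omega> t)) (at t within {t\<^sub>0..T}) \<and>
          (\<omega> has_vector_derivative \<omega>' t) (at t within {t\<^sub>0..T}) \<and>
          m *\<^sub>R \<omega>' t =
            - (m *\<^sub>R cross3 (\<Omega> t - \<omega> t) (\<omega> t)) + feedback \<phi> E W U t (R t) - D *v \<omega> t))"

text \<open>The half-step value \<open>\<omega>\<^bsub>i+1/2\<^esub>\<close>, computed from the state at \<open>t = t\<^sub>i\<close>.\<close>

definition half_step ::
  "real \<Rightarrow> real^3^3 \<Rightarrow> (real \<Rightarrow> real) \<Rightarrow>
   (real \<Rightarrow> real^'n^3) \<Rightarrow> (real \<Rightarrow> real^'n^'n) \<Rightarrow> (real \<Rightarrow> real^'n^3) \<Rightarrow> (real \<Rightarrow> real^3) \<Rightarrow>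
   real \<Rightarrow> real \<Rightarrow> (real^3^3) \<times> (real^3) \<Rightarrow> real^3" where
  "half_step m D \<phi> E W U \<Omega> t h = (\<lambda>(R, \<omega>).
     matrix_inv (m *\<^sub>R mat 1 + (h / 2) *\<^sub>R D) *v
       (mat_exp (- (h / 2) *\<^sub>R skew (\<Omega> t - \<omega>)) *v (m *\<^sub>R \<omega>) + (h / 2) *\<^sub>R feedback \<phi> E W U t R))"

text \<open>The step is implicit: \<open>\<omega>\<^sub>1\<close> also enters the estimate \<open>\<Omega> (t + h) - \<omega>\<^sub>1\<close> on the right.\<close>

definition filter_step ::
  "real \<Rightarrow> real^3^3 \<Rightarrow> (real \<Rightarrow> real) \<Rightarrow>
   (real \<Rightarrow> real^'n^3) \<Rightarrow> (real \<Rightarrow> real^'n^'n) \<Rightarrow> (real \<Rightarrow> real^'n^3) \<Rightarrow> (real \<Rightarrow> real^3) \<Rightarrow>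
   real \<Rightarrow> real \<Rightarrow> (real^3^3) \<times> (real^3) \<Rightarrow> (real^3^3) \<times> (real^3) \<Rightarrow> bool" where
  "filter_step m D \<phi> E W U \<Omega> t h = (\<lambda>(R, \<omega>) (R\<^sub>1, \<omega>\<^sub>1).
     let \<omega>h = half_step m D \<phi> E W U \<Omega> t h (R, \<omega>);
         \<Omega>h = (1 / 2) *\<^sub>R (\<Omega> t + \<Omega> (t + h))
     in R\<^sub>1 = R ** mat_exp (h *\<^sub>R skew (\<Omega>h - \<omega>h)) \<and>
        m *\<^sub>R \<omega>\<^sub>1 = mat_exp (- (h / 2) *\<^sub>R skew (\<Omega> (t + h) - \<omega>\<^sub>1)) *v
          ((m *\<^sub>R mat 1 - (h / 2) *\<^sub>R D) *v \<omega>h + (h / 2) *\<^sub>R feedback \<phi> E W U (t + h) R\<^sub>1))"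

end

theory Submission
  imports Defs
begin

text \<open>The velocity update from \<open>t\<^sub>i\<close> to \<open>t\<^bsub>i+1/2\<^esub>\<close> and the one from \<open>t\<^bsub>i+1/2\<^esub>\<close> to
  \<open>t\<^bsub>i+1\<^esub>\<close> are adjoint to each other (replace \<open>h\<close> by \<open>-h\<close> and exchange the end points),
  and the attitude update is the exponential midpoint rule, so the composed step has local error
  \<open>O(h\<^sup>3)\<close>. Since \<open>E\<close>, \<open>W\<close>, \<open>U\<close> and \<open>\<Omega>\<close> are only assumed to be continuous, the expansions
  use only derivatives of the solution: the feedback is eliminated through the differential
  equation, and \<open>\<Omega> - \<omega>\<close> is controlled by \<open>skew (\<Omega> - \<omega>) = R\<^sup>T R'\<close>. The numerical and the exact step
  are compared directly, for any starting point within distance 1 of the exact solution: writing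
  \<open>\<epsilon>\<close> and \<open>\<epsilon>'\<close> for the errors before and after the step,
  \<open>\<epsilon>' \<le> \<epsilon> + C h (\<epsilon> + \<epsilon>' + h\<^sup>2)\<close>, which yields both the local and the global bound. The
  exponential of a skew matrix is an isometry; this bounds every solution of the implicit velocity
  equation a priori and makes Brouwer's theorem applicable to its solvability.\<close>

section \<open>Matrix norms\<close>

text \<open>The half-step velocity agrees with \<open>\<omega> (t + h / 2)\<close> only up to h^2
  after one step from exact data. This suffices because it is used only with a factor h in front: in
  the exponent of the attitude update, and in the velocity update once the half-step equation has
  eliminated \<open>m *\<^sub>R wh\<close>, which leaves \<open>- h *\<^sub>R (D *v wh)\<close>. The
  feedback then occurs as the sum of its values at both ends of the step, exactly what the
  trapezoidal rule for \<open>\<omega>'\<close> delivers, so no time derivative of the feedback is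
  formed. All estimates live on a single scale, starting error plus h^2, uniformly over the set of
  all admissible numerical steps. Only the implicit equation does not fit this scale, because the
  unknown end velocity sits inside the exponential. Its error is first bounded by a constant, then
  added to the scale, and finally absorbed on the left for small h.\<close>

lemma norm_matrix_vector_mult_le: "norm (A *v x) \<le> norm A * norm x"
  for A :: "real^'n^'m"
proof -
  have "norm (A *v x) = L2_set (\<lambda>i. norm (A $ i \<bullet> x)) UNIV"
    by (simp add: norm_vec_def matrix_vector_mul_component)
  also have "\<dots> \<le> L2_set (\<lambda>i. norm x * norm (A $ i)) UNIV"
    by (intro L2_set_mono) (auto simp: mult.commute[of "norm x"] Cauchy_Schwarz_ineq2)
  also have "\<dots> = norm x * L2_set (\<lambda>i. norm (A $ i)) UNIV"
    by (simp add: L2_set_right_distrib)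
  also have "\<dots> = norm A * norm x"
    by (simp add: norm_vec_def)
  finally show ?thesis .
qed

lemma norm_transpose: "norm (transpose A) = norm A"
  for A :: "real^'n^'m"
proof -
  have "(norm (transpose A))\<^sup>2 = (norm A)\<^sup>2"
    unfolding power2_norm_eq_inner inner_vec_def
    by (subst sum.swap) (simp add: transpose_def)
  then show ?thesis
    by simp
qed

text \<open>The norm of \<open>real^'n^'m\<close> is the Frobenius norm. The rows of
  \<open>A ** B\<close> are the images of the rows of \<open>A\<close> under
  \<open>transpose B\<close>, and transposition preserves the norm, so submultiplicativity holds
  with constant 1.\<close>

lemma norm_matrix_mult_le: "norm (A ** B) \<le> norm A * norm B"
  for A :: "real^'n^'m" and B :: "real^'p^'n"
proof -
  have "norm (A ** B) = L2_set (\<lambda>i. norm (transpose B *v (A $ i))) UNIV"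
  proof -
    have "(A ** B) $ i = transpose B *v (A $ i)" for i
      by (simp add: vec_eq_iff matrix_matrix_mult_def vector_matrix_mult_def mult.commute)
    then show ?thesis
      by (simp only: norm_vec_def)
  qed
  also have "\<dots> \<le> L2_set (\<lambda>i. norm B * norm (A $ i)) UNIV"
    using norm_matrix_vector_mult_le[of "transpose B"] by (intro L2_set_mono) (auto simp: norm_transpose)
  also have "\<dots> = norm B * L2_set (\<lambda>i. norm (A $ i)) UNIV"
    by (simp add: L2_set_right_distrib)
  also have "\<dots> = norm A * norm B"
    by (simp add: norm_vec_def)
  finally show ?thesis .
qed

lemma matrix_add_rdistrib: "(A + B) ** C = A ** C + B ** C"
  for A B :: "real^'n^'m" and C :: "real^'p^'n"
  by (simp add: vec_eq_iff matrix_matrix_mult_def distrib_right sum.distrib)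

lemma scaleR_matrix_mult: "(c *\<^sub>R A) ** B = c *\<^sub>R (A ** B)"
  for A :: "real^'n^'m" and B :: "real^'p^'n"
  by (simp add: vec_eq_iff matrix_matrix_mult_def sum_distrib_left mult.assoc)

lemma matrix_mult_scaleR: "A ** (c *\<^sub>R B) = c *\<^sub>R (A ** B)"
  for A :: "real^'n^'m" and B :: "real^'p^'n"
  by (simp add: vec_eq_iff matrix_matrix_mult_def sum_distrib_left mult.left_commute)

text \<open>Matrix products, matrix-vector products, \<open>rot\<close> and \<open>cross3\<close>
  are all handled through \<open>bounded_bilinear\<close>, so the same rules for differences and
  domination serve all four.\<close>

lemma bounded_bilinear_matrix_mult:
  "bounded_bilinear ((**) :: real^'n^'m \<Rightarrow> real^'p^'n \<Rightarrow> real^'p^'m)"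
  by (rule bounded_bilinear.intro)
    (simp_all add: matrix_add_ldistrib matrix_add_rdistrib scaleR_matrix_mult matrix_mult_scaleR
      norm_matrix_mult_le exI[of _ 1])

lemma bounded_bilinear_matrix_vector_mult:
  "bounded_bilinear ((*v) :: real^'n^'m \<Rightarrow> real^'n \<Rightarrow> real^'m)"
  by (rule bounded_bilinear.intro)
    (simp_all add: matrix_vector_mult_add_rdistrib matrix_vector_right_distrib
      scaleR_matrix_vector_assoc matrix_vector_mult_scaleR norm_matrix_vector_mult_le exI[of _ 1])

lemma bounded_bilinear_cross3: "bounded_bilinear cross3"
  using bilinear_cross bilinear_conv_bounded_bilinear by blast

section \<open>The matrix exponential\<close>

abbreviation mat_pow :: "real^'n^'n \<Rightarrow> nat \<Rightarrow> real^'n^'n" where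
  "mat_pow A k \<equiv> ((\<lambda>B. A ** B) ^^ k) (mat 1)"

text \<open>The factor \<open>norm (mat 1)\<close> stays because the Frobenius norm of the identity
  is the square root of the dimension.\<close>

lemma norm_mat_pow_le: "norm (mat_pow A k) \<le> norm (mat 1 :: real^'n^'n) * norm A ^ k"
  for A :: "real^'n^'n"
proof (induction k)
  case (Suc k)
  have "norm (mat_pow A (Suc k)) \<le> norm A * norm (mat_pow A k)"
    by (simp add: norm_matrix_mult_le)
  also have "\<dots> \<le> norm A * (norm (mat 1 :: real^'n^'n) * norm A ^ k)"
    by (intro mult_left_mono Suc) auto
  finally show ?case
    by (simp add: mult_ac)
qed simp

text \<open>Telescoping: A^(k+1) - B^(k+1) = A (A^k - B^k) + (A - B) B^k. The factor (1 + M)^k is a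
  majorant of k M^(k-1) that closes the induction through M (1 + M)^k + (1 + M)^k = (1 +
  M)^(k+1).\<close>

lemma norm_mat_pow_diff_le:
  fixes A B :: "real^'n^'n"
  assumes "norm A \<le> M" "norm B \<le> M"
  shows "norm (mat_pow A k - mat_pow B k) \<le> norm (mat 1 :: real^'n^'n) * (1 + M) ^ k * norm (A - B)"
proof (induction k)
  case (Suc k)
  let ?I = "norm (mat 1 :: real^'n^'n)"
  have M: "0 \<le> M"
    using assms(1) norm_ge_zero order_trans by blast
  have "mat_pow A (Suc k) - mat_pow B (Suc k)
      = A ** (mat_pow A k - mat_pow B k) + (A - B) ** mat_pow B k"
    by (simp add: bounded_bilinear.diff_left[OF bounded_bilinear_matrix_mult]
        bounded_bilinear.diff_right[OF bounded_bilinear_matrix_mult])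
  then have "norm (mat_pow A (Suc k) - mat_pow B (Suc k))
      \<le> norm A * norm (mat_pow A k - mat_pow B k) + norm (A - B) * norm (mat_pow B k)"
    using norm_triangle_mono[OF norm_matrix_mult_le norm_matrix_mult_le] by metis
  also have "\<dots> \<le> M * (?I * (1 + M) ^ k * norm (A - B)) + norm (A - B) * (?I * (1 + M) ^ k)"
  proof (intro add_mono mult_mono Suc assms)
    have "norm (mat_pow B k) \<le> ?I * norm B ^ k"
      by (rule norm_mat_pow_le)
    also have "\<dots> \<le> ?I * (1 + M) ^ k"
      using assms(2) by (intro mult_left_mono power_mono) auto
    finally show "norm (mat_pow B k) \<le> ?I * (1 + M) ^ k" .
  qed (use M in auto)
  also have "\<dots> = ?I * (1 + M) ^ Suc k * norm (A - B)"
    by (simp add: algebra_simps)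
  finally show ?case .
qed simp

lemma summable_exp_real: "summable (\<lambda>k. (1 / fact k) * (x::real) ^ k)"
  using summable_exp[of x] by (simp add: field_simps)

lemma suminf_exp_real: "(\<Sum>k. (1 / fact k) * (x::real) ^ k) = exp x"
  by (simp add: exp_def field_simps)

lemma mat_exp_summable: "summable (\<lambda>k. (1 / fact k) *\<^sub>R mat_pow A k)"
  for A :: "real^'n^'n"
proof (rule summable_norm_cancel, rule summable_comparison_test)
  show "summable (\<lambda>k. norm (mat 1 :: real^'n^'n) * ((1 / fact k) * norm A ^ k))"
    by (intro summable_mult summable_exp_real)
  show "\<exists>N. \<forall>k\<ge>N. norm (norm ((1 / fact k) *\<^sub>R mat_pow A k))
      \<le> norm (mat 1 :: real^'n^'n) * ((1 / fact k) * norm A ^ k)"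
    using norm_mat_pow_le[where A = A] by (auto simp: field_simps)
qed

lemma mat_exp_diff_le:
  fixes A B :: "real^'n^'n"
  assumes "norm A \<le> M" "norm B \<le> M"
  shows "norm (mat_exp A - mat_exp B) \<le> norm (mat 1 :: real^'n^'n) * exp (1 + M) * norm (A - B)"
proof -
  let ?I = "norm (mat 1 :: real^'n^'n)"
  let ?g = "\<lambda>k. (?I * norm (A - B)) * ((1 / fact k) * (1 + M) ^ k)"
  have "mat_exp A - mat_exp B = (\<Sum>k. (1 / fact k) *\<^sub>R (mat_pow A k - mat_pow B k))"
    unfolding mat_exp_def scaleR_diff_right
    by (rule suminf_diff[OF mat_exp_summable mat_exp_summable])
  also have "norm \<dots> \<le> (\<Sum>k. ?g k)"
  proof (rule norm_suminf_le)
    fix k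
    show "norm ((1 / fact k) *\<^sub>R (mat_pow A k - mat_pow B k)) \<le> ?g k"
      using norm_mat_pow_diff_le[OF assms, of k] by (simp add: divide_right_mono mult_ac)
  qed (intro summable_mult summable_exp_real)
  also have "\<dots> = (?I * norm (A - B)) * exp (1 + M)"
    using suminf_mult[OF summable_exp_real[of "1 + M"]] by (simp only: suminf_exp_real)
  finally show ?thesis
    by (simp add: mult_ac)
qed

text \<open>Since 1/(k+3)! \<le> 1/k!, the tail of the series is at most |A|^3 times the full scalar
  exponential series. Terms up to the second order stay explicit because a local error of order h^3
  has to be matched through h^2.\<close>

lemma mat_exp_remainder_le:
  fixes A :: "real^'n^'n"
  shows "norm (mat_exp A - (mat 1 + A + (1/2) *\<^sub>R (A ** A)))
    \<le> norm (mat 1 :: real^'n^'n) * exp (norm A) * norm A ^ 3"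
proof -
  let ?I = "norm (mat 1 :: real^'n^'n)"
  let ?f = "\<lambda>k. (1 / fact k) *\<^sub>R mat_pow A k"
  let ?g = "\<lambda>k. (?I * norm A ^ 3) * ((1 / fact k) * norm A ^ k)"
  have "mat_exp A - (mat 1 + A + (1/2) *\<^sub>R (A ** A)) = mat_exp A - (\<Sum>k<3. ?f k)"
    by (simp add: numeral_3_eq_3)
  also have "\<dots> = (\<Sum>k. ?f (k + 3))"
    unfolding mat_exp_def
    using suminf_split_initial_segment[OF mat_exp_summable[of A], of 3] by (simp only: add_diff_cancel_left' add.commute diff_eq_eq)
  also have "norm \<dots> \<le> (\<Sum>k. ?g k)"
  proof (rule norm_suminf_le)
    fix k
    have "fact k \<le> (fact (k + 3) :: real)"
      by (rule fact_mono) simp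
    then have "(1 / fact (k + 3)) * (?I * norm A ^ (k + 3)) \<le> (1 / fact k) * (?I * norm A ^ (k + 3))"
      by (intro mult_right_mono divide_left_mono) auto
    moreover have "norm (?f (k + 3)) \<le> (1 / fact (k + 3)) * (?I * norm A ^ (k + 3))"
      using norm_mat_pow_le[of "k + 3" A] by (simp only: norm_scaleR) (intro mult_mono; simp)
    ultimately show "norm (?f (k + 3)) \<le> ?g k"
      by (simp add: power_add mult_ac)
  qed (intro summable_mult summable_exp_real)
  also have "\<dots> = (?I * norm A ^ 3) * exp (norm A)"
    using suminf_mult[OF summable_exp_real[of "norm A"]] by (simp only: suminf_exp_real)
  finally show ?thesis
    by (simp add: mult_ac)
qed

lemma mat_pow_scaleR: "mat_pow (s *\<^sub>R A) k = s ^ k *\<^sub>R mat_pow A k"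
  by (induction k) (simp_all add: scaleR_matrix_mult matrix_mult_scaleR)

text \<open>The curve e(s) = exp(sA) x solves e' = A e, and the derivative of e . e is 2 e . (A e) =
  0. The differential equation is obtained for each component separately, where e is a real power
  series that can be differentiated term by term.\<close>

lemma norm_mat_exp_antisymmetric:
  fixes A :: "real^'n^'n"
  assumes "\<And>y. y \<bullet> (A *v y) = 0"
  shows "norm (mat_exp A *v x) = norm x"
proof -
  let ?e = "\<lambda>s. mat_exp (s *\<^sub>R A) *v x"
  define c where "c i k = (1 / fact k) * (mat_pow A k *v x) $ i" for i k
  have lin: "bounded_linear (\<lambda>M. (M *v y) $ i)" for y :: "real^'n" and i :: 'n
    by (intro bounded_linear_compose[OF bounded_linear_vec_nth]
        bounded_bilinear.bounded_linear_left[OF bounded_bilinear_matrix_vector_mult])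
  have ser: "(((1 / fact k) *\<^sub>R mat_pow (s *\<^sub>R A) k) *v x) $ i = c i k * s ^ k" for s i k
    by (simp add: c_def mat_pow_scaleR scaleR_matrix_vector_assoc[symmetric])
  have sm: "summable (\<lambda>k. c i k * s ^ k)" for i s
    using bounded_linear.summable[OF lin mat_exp_summable, of "s *\<^sub>R A" x i] by (simp only: ser)
  have e: "?e s $ i = (\<Sum>k. c i k * s ^ k)" for i s
    unfolding mat_exp_def
    using bounded_linear.suminf[OF lin mat_exp_summable, of "s *\<^sub>R A" x i] by (simp only: ser)
  have lin': "bounded_linear (\<lambda>M. (A *v (M *v y)) $ i)" for y :: "real^'n" and i :: 'n
    by (intro bounded_linear_compose[OF bounded_linear_vec_nth]
        bounded_linear_compose[OF matrix_vector_mul_bounded_linear]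
        bounded_bilinear.bounded_linear_left[OF bounded_bilinear_matrix_vector_mult])
  \<comment> \<open>The index shift in the derived coefficients cancels one factor of the factorial
    and releases one factor \<open>A\<close>.\<close>
  have diffs: "diffs (c i) k * s ^ k = (A *v (((1 / fact k) *\<^sub>R mat_pow (s *\<^sub>R A) k) *v x)) $ i" for i k s
  proof -
    have "diffs (c i) k = (1 / fact k) * (A *v (mat_pow A k *v x)) $ i"
      by (simp add: diffs_def c_def matrix_vector_mul_assoc)
    then show ?thesis
      by (simp add: mat_pow_scaleR scaleR_matrix_vector_assoc[symmetric] matrix_vector_mult_scaleR)
  qed
  have Ae: "(\<Sum>k. diffs (c i) k * s ^ k) = (A *v ?e s) $ i" for i s
    unfolding mat_exp_def diffs
    by (rule bounded_linear.suminf[OF lin' mat_exp_summable, symmetric])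
  have d: "((\<lambda>s. ?e s $ i) has_real_derivative (A *v ?e s) $ i) (at s)" for i s
    unfolding e Ae[symmetric] by (rule termdiffs_strong_converges_everywhere) (rule sm)
  have "((\<lambda>s. ?e s \<bullet> ?e s) has_real_derivative 0) (at s)" for s
  proof -
    have "((\<lambda>s. \<Sum>i\<in>UNIV. ?e s $ i * ?e s $ i) has_real_derivative
        (\<Sum>i\<in>UNIV. (A *v ?e s) $ i * ?e s $ i + (A *v ?e s) $ i * ?e s $ i)) (at s)"
      by (intro DERIV_sum DERIV_mult d)
    moreover have "(\<Sum>i\<in>UNIV. (A *v ?e s) $ i * ?e s $ i + (A *v ?e s) $ i * ?e s $ i)
        = 0"
      using assms[of "?e s"]
      by (simp add: inner_vec_def sum_distrib_left[symmetric] mult.commute[of "(A *v _) $ _"])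
    ultimately show ?thesis
      by (simp add: inner_vec_def)
  qed
  from DERIV_isconst_all[OF allI, OF this, of 1 0] have "?e 1 \<bullet> ?e 1 = ?e 0 \<bullet> ?e 0" .
  \<comment> \<open>The remainder bound has right-hand side 0 at the zero matrix and so doubles as
    the value of the exponential there.\<close>
  moreover have "mat_exp (0 *\<^sub>R A) = mat 1"
    using mat_exp_remainder_le[of "0 *\<^sub>R A"] by (simp add: bounded_bilinear.zero_left[OF bounded_bilinear_matrix_mult])
  ultimately show ?thesis
    by (simp add: norm_eq_sqrt_inner)
qed

section \<open>Skew matrices\<close>

lemma skew_mult_vector [simp]: "skew a *v x = cross3 a x"
  unfolding skew_def
  using bounded_linear.linear[OF bounded_bilinear.bounded_linear_right[OF bounded_bilinear_cross3]]
  by (simp add: matrix_works)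

lemma bounded_linear_skew: "bounded_linear skew"
  by (simp add: linear_conv_bounded_linear[symmetric])
    (rule linearI; simp add: matrix_eq algebra_simps cross_add_left cross_mult_left
      scaleR_matrix_vector_assoc[symmetric])

lemma skew_components:
  "skew a $ 1 $ 1 = 0" "skew a $ 1 $ 2 = - a $ 3" "skew a $ 1 $ 3 = a $ 2"
  "skew a $ 2 $ 1 = a $ 3" "skew a $ 2 $ 2 = 0" "skew a $ 2 $ 3 = - a $ 1"
  "skew a $ 3 $ 1 = - a $ 2" "skew a $ 3 $ 2 = a $ 1" "skew a $ 3 $ 3 = 0"
  by (simp_all add: skew_def matrix_def cross3_def axis_def vector_def)

lemma inj_skew: "inj skew"
  by (rule injI) (metis (no_types) skew_components(2,3,6) exhaust_3 vec_eq_iff neg_equal_iff_equal)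

lemma vex_skew [simp]: "vex (skew a) = a"
  by (simp add: vex_def inj_skew)

lemma skew_symmetric_eq_skew:
  assumes "transpose M = - M"
  shows "M = skew (vector [M $ 3 $ 2, M $ 1 $ 3, M $ 2 $ 1])"
proof -
  have "M $ i $ j = - M $ j $ i" for i j
    using arg_cong[OF assms, of "\<lambda>M. M $ j $ i"] by (simp add: transpose_def)
  note this[of 1 1] this[of 2 2] this[of 3 3] this[of 1 2] this[of 2 3] this[of 3 1]
  then show ?thesis
    by (simp add: vec_eq_iff forall_3 skew_components)
qed

text \<open>In the Frobenius norm \<open>skew a\<close> is longer than \<open>a\<close> by the
  factor sqrt 2. The inequality carries bounds back from matrices to vectors, both for the
  innovation and for the estimate \<open>\<Omega> t - \<omega> t\<close>.\<close>

lemma norm_le_norm_skew: "norm a \<le> norm (skew a)"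
  unfolding norm_le power2_norm_eq_inner
  by (simp add: inner_vec_def sum_3 skew_components)

lemma mat_exp_skew_norm: "norm (mat_exp (skew a) *v x) = norm x"
  by (rule norm_mat_exp_antisymmetric) (simp add: dot_cross_self)

section \<open>A mean value inequality\<close>

lemma vector_mean_value:
  fixes f :: "real \<Rightarrow> 'a::real_normed_vector"
  assumes "\<And>t. t \<in> {a..b} \<Longrightarrow> (f has_vector_derivative f' t) (at t within {a..b})"
    and "\<And>t. t \<in> {a..b} \<Longrightarrow> norm (f' t) \<le> B"
    and "x \<in> {a..b}" "y \<in> {a..b}"
  shows "norm (f x - f y) \<le> B * \<bar>x - y\<bar>"
proof -
  have B: "0 \<le> B"
    using assms(2)[OF assms(3)] norm_ge_zero order_trans by blast
  have "norm (f x - f y) \<le> B * norm (x - y)"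
  proof (rule differentiable_bound[OF convex_real_interval(5)])
    show "(f has_derivative (\<lambda>h. h *\<^sub>R f' t)) (at t within {a..b})" if "t \<in> {a..b}" for t
      using assms(1)[OF that] by (simp add: has_vector_derivative_def)
    show "onorm (\<lambda>h. h *\<^sub>R f' t) \<le> B" if "t \<in> {a..b}" for t
      using assms(2)[OF that] B by (intro onorm_bound) (auto simp: mult.commute[of B] mult_left_mono)
  qed (use assms in auto)
  then show ?thesis
    by simp
qed

section \<open>The feedback term\<close>

lemma mat_inner_eq_inner: "mat_inner A B = A \<bullet> B"
  unfolding mat_inner_def trace_def inner_vec_def matrix_matrix_mult_def transpose_def
  by (subst sum.swap) simp

text \<open>The trace form splits into the values of the quadratic form of \<open>W\<close> at the
  rows of the residual. The sign matters because \<open>gain_function\<close> controls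
  \<open>\<phi>\<close> on the half-line only.\<close>

lemma potential_nonneg:
  assumes "positive_definite W"
  shows "0 \<le> potential E W R U"
proof -
  let ?X = "E - R ** U"
  have "mat_inner ?X (?X ** W) = (\<Sum>i\<in>UNIV. ?X $ i \<bullet> (W *v (?X $ i)))"
  proof -
    have "(?X ** W) $ i = transpose W *v (?X $ i)" for i
      by (simp add: vec_eq_iff matrix_matrix_mult_def vector_matrix_mult_def mult.commute)
    moreover have "transpose W = W"
      using assms by (simp add: positive_definite_def)
    ultimately have "(?X ** W) $ i = W *v (?X $ i)" for i
      by metis
    then show ?thesis
      unfolding mat_inner_eq_inner by (subst inner_vec_def) simp
  qed
  also have "\<dots> \<ge> 0"
  proof (rule sum_nonneg)
    fix i
    show "0 \<le> ?X $ i \<bullet> (W *v (?X $ i))"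
      using assms by (cases "?X $ i = 0") (auto simp: positive_definite_def intro: less_imp_le)
  qed
  finally show ?thesis
    by (simp add: potential_def)
qed

lemma norm_residual_le:
  fixes E U :: "real^'n^3" and R :: "real^3^3"
  assumes "norm E \<le> M" "norm U \<le> M" "norm R \<le> B"
  shows "norm (E - R ** U) \<le> M + B * M"
proof -
  have "norm (E - R ** U) \<le> norm E + norm (R ** U)"
    by (rule norm_triangle_ineq4)
  also have "\<dots> \<le> M + norm R * norm U"
    by (intro add_mono assms norm_matrix_mult_le)
  also have "\<dots> \<le> M + B * M"
    using assms order_trans[OF norm_ge_zero assms(3)] by (intro add_left_mono mult_mono) auto
  finally show ?thesis .
qed

text \<open>Both summands of X . XW - Y . YW = (X - Y) . XW + Y . (X - Y)W have the same bound, and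
  the resulting 2 cancels against the 1/2 in the potential.\<close>

lemma potential_diff_le:
  fixes E U :: "real^'n^3"
  assumes "norm E \<le> M" "norm W \<le> M" "norm U \<le> M" "norm R \<le> B" "norm S \<le> B"
  shows "\<bar>potential E W R U - potential E W S U\<bar> \<le> (M + B * M) * M * M * norm (R - S)"
proof -
  let ?X = "E - R ** U" and ?Y = "E - S ** U"
  have M: "0 \<le> M" and B: "0 \<le> B"
    using assms norm_ge_zero order_trans by blast+
  have X: "norm ?X \<le> M + B * M" and Y: "norm ?Y \<le> M + B * M"
    using assms by (auto intro: norm_residual_le)
  have XY: "?X - ?Y = (S - R) ** U"
    by (simp add: bounded_bilinear.diff_left[OF bounded_bilinear_matrix_mult])
  have d: "norm (?X - ?Y) \<le> norm (R - S) * M"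
    unfolding XY norm_minus_commute[of R S]
    by (rule order_trans[OF norm_matrix_mult_le mult_left_mono[OF assms(3) norm_ge_zero]])
  have "?X \<bullet> (?X ** W) - ?Y \<bullet> (?Y ** W) = (?X - ?Y) \<bullet> (?X ** W) + ?Y \<bullet> ((?X - ?Y) ** W)"
    by (simp only: inner_diff_left inner_diff_right bounded_bilinear.diff_left[OF bounded_bilinear_matrix_mult])
  also have "\<bar>\<dots>\<bar> \<le> norm (?X - ?Y) * norm (?X ** W) + norm ?Y * norm ((?X - ?Y) ** W)"
    by (intro order_trans[OF abs_triangle_ineq] add_mono Cauchy_Schwarz_ineq2)
  also have "\<dots> \<le> norm (?X - ?Y) * (norm ?X * norm W) + norm ?Y * (norm (?X - ?Y) * norm W)"
    by (intro add_mono mult_left_mono norm_matrix_mult_le) auto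
  also have "\<dots> \<le> (norm (R - S) * M) * ((M + B * M) * M) + (M + B * M) * ((norm (R - S) * M) * M)"
    using M B by (intro add_mono mult_mono X Y d assms) auto
  finally show ?thesis
    by (simp add: potential_def mat_inner_eq_inner algebra_simps)
qed

lemma skew_vex:
  assumes "transpose M = - M"
  shows "skew (vex M) = M"
  using skew_symmetric_eq_skew[OF assms] by (metis vex_skew)

text \<open>The difference is antisymmetric, hence in the range of \<open>skew\<close>, where
  \<open>vex\<close> is a genuine inverse. The size and the linearity of the innovation are read off
  from this matrix identity.\<close>

lemma skew_innovation: "skew (innovation L R) = transpose L ** R - transpose R ** L"
  unfolding innovation_def
  by (rule skew_vex) (simp add: vec_eq_iff transpose_def matrix_matrix_mult_def mult.commute)

lemma norm_innovation_le: "norm (innovation L R) \<le> 2 * norm L * norm R"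
proof -
  have "norm (innovation L R) \<le> norm (transpose L ** R - transpose R ** L)"
    using norm_le_norm_skew[of "innovation L R"] by (simp add: skew_innovation)
  also have "\<dots> \<le> norm (transpose L ** R) + norm (transpose R ** L)"
    by (rule norm_triangle_ineq4)
  also have "\<dots> \<le> norm L * norm R + norm R * norm L"
    using norm_matrix_mult_le[of "transpose L" R] norm_matrix_mult_le[of "transpose R" L]
    unfolding norm_transpose by (rule add_mono)
  finally show ?thesis
    by (simp add: mult_ac)
qed

lemma innovation_diff: "innovation L R - innovation L S = innovation L (R - S)"
proof (rule injD[OF inj_skew])
  have "transpose (R - S) = transpose R - transpose S"
    by (simp add: vec_eq_iff transpose_def)
  then show "skew (innovation L R - innovation L S) = skew (innovation L (R - S))"
    by (simp add: linear_diff[OF bounded_linear.linear[OF bounded_linear_skew]] skew_innovation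
        bounded_bilinear.diff_left[OF bounded_bilinear_matrix_mult]
        bounded_bilinear.diff_right[OF bounded_bilinear_matrix_mult])
qed

text \<open>Once \<open>\<phi>\<close> is identified with the derivative that witnesses the C^2
  condition, a bound of the continuous second derivative on the compact interval is a Lipschitz
  constant for it.\<close>

lemma gain_derivative_bounds:
  assumes "gain_function \<Phi> \<phi>" and "0 \<le> P"
  obtains C where "0 \<le> C" "\<And>x. x \<in> {0..P} \<Longrightarrow> \<bar>\<phi> x\<bar> \<le> C"
    "\<And>x y. x \<in> {0..P} \<Longrightarrow> y \<in> {0..P} \<Longrightarrow> \<bar>\<phi> x - \<phi> y\<bar> \<le> C * \<bar>x - y\<bar>"
proof -
  obtain \<Phi>' \<Phi>'' where d1: "\<And>x. x \<ge> 0 \<Longrightarrow> (\<Phi> has_vector_derivative \<Phi>' x) (at x within {0..})"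
    and d2: "\<And>x. x \<ge> 0 \<Longrightarrow> (\<Phi>' has_vector_derivative \<Phi>'' x) (at x within {0..})"
    and c: "continuous_on {0..} \<Phi>''"
    using assms(1) unfolding gain_function_def numeral_2_eq_2 Cn_on.simps by (metis atLeast_iff)
  \<comment> \<open>At x = 0 the derivative is one-sided, so uniqueness is taken on the
    nondegenerate interval [0, x + 1].\<close>
  have eq: "\<phi> x = \<Phi>' x" if "x \<ge> 0" for x
  proof (rule vector_derivative_unique_within_closed_interval)
    have "(\<Phi> has_vector_derivative \<phi> x) (at x within {0..})"
      using assms(1) that
      by (simp add: gain_function_def has_real_derivative_iff_has_vector_derivative)
    then show "(\<Phi> has_vector_derivative \<phi> x) (at x within cbox 0 (x + 1))"
      by (rule has_vector_derivative_within_subset) auto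
    show "(\<Phi> has_vector_derivative \<Phi>' x) (at x within cbox 0 (x + 1))"
      by (rule has_vector_derivative_within_subset[OF d1[OF that]]) auto
  qed (use that in auto)
  have "bounded (\<Phi>'' ` {0..P})"
    by (intro compact_imp_bounded compact_continuous_image continuous_on_subset[OF c]) auto
  then obtain C where C: "\<And>x. x \<in> {0..P} \<Longrightarrow> \<bar>\<Phi>'' x\<bar> \<le> C"
    unfolding bounded_iff real_norm_def by blast
  have C0: "0 \<le> C"
    using C[of 0] assms(2) by simp
  have lip: "\<bar>\<phi> x - \<phi> y\<bar> \<le> C * \<bar>x - y\<bar>" if "x \<in> {0..P}" "y \<in> {0..P}" for x y
  proof -
    have "norm (\<Phi>' x - \<Phi>' y) \<le> C * \<bar>x - y\<bar>"
    proof (rule vector_mean_value[OF _ _ that])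
      show "(\<Phi>' has_vector_derivative \<Phi>'' z) (at z within {0..P})" if "z \<in> {0..P}" for z
        using that by (intro has_vector_derivative_within_subset[OF d2]) auto
    qed (use C in simp)
    then show ?thesis
      using that by (simp add: eq)
  qed
  show thesis
  proof (rule that[of "\<bar>\<phi> 0\<bar> + C * P + C"])
    fix x assume x: "x \<in> {0..P}"
    have "\<bar>\<phi> x - \<phi> 0\<bar> \<le> C * P"
      using lip[OF x, of 0] x C0 assms(2) mult_left_mono[of x P C] by auto
    then show "\<bar>\<phi> x\<bar> \<le> \<bar>\<phi> 0\<bar> + C * P + C"
      using C0 by linarith
    fix y assume y: "y \<in> {0..P}"
    show "\<bar>\<phi> x - \<phi> y\<bar> \<le> (\<bar>\<phi> 0\<bar> + C * P + C) * \<bar>x - y\<bar>"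
      using lip[OF x y] C0 assms(2) by (simp add: distrib_right add_nonneg_nonneg add_increasing)
  qed (use C0 assms(2) in auto)
qed

text \<open>Compactness bounds the data, so the potential stays in one interval {0..P} on which
  \<open>\<phi>\<close> is bounded and Lipschitz. The bounds are stated on balls of matrices rather
  than on rotations because the starting attitude of a compared numerical step is arbitrary near the
  exact one and may fail to be a rotation.\<close>

lemma feedback_bounds:
  assumes gain: "gain_function \<Phi> \<phi>"
    and cont: "continuous_on S E" "continuous_on S W" "continuous_on S U" and "compact S"
    and W: "\<And>t. t \<in> S \<Longrightarrow> positive_definite (W t)"
    and "0 \<le> B"
  obtains C where "0 \<le> C"
    "\<And>t R. t \<in> S \<Longrightarrow> norm R \<le> B \<Longrightarrow> norm (feedback \<phi> E W U t R) \<le> C"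
    "\<And>t R R'. t \<in> S \<Longrightarrow> norm R \<le> B \<Longrightarrow> norm R' \<le> B \<Longrightarrow>
       norm (feedback \<phi> E W U t R - feedback \<phi> E W U t R') \<le> C * norm (R - R')"
proof -
  have "bounded (E ` S)" "bounded (W ` S)" "bounded (U ` S)"
    using cont \<open>compact S\<close> by (auto intro!: compact_imp_bounded compact_continuous_image)
  then obtain M1 M2 M3 where *: "\<And>t. t \<in> S \<Longrightarrow> norm (E t) \<le> M1" "\<And>t. t \<in> S \<Longrightarrow> norm (W t) \<le> M2"
    "\<And>t. t \<in> S \<Longrightarrow> norm (U t) \<le> M3"
    unfolding bounded_iff by (metis imageI)
  \<comment> \<open>The 0 keeps \<open>M\<close> nonnegative when \<open>S\<close> is empty.\<close>
  define M where "M = max 0 (max M1 (max M2 M3))"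
  have M0: "0 \<le> M" and M: "\<And>t. t \<in> S \<Longrightarrow> norm (E t) \<le> M" "\<And>t. t \<in> S \<Longrightarrow> norm (W t) \<le> M"
    "\<And>t. t \<in> S \<Longrightarrow> norm (U t) \<le> M"
    using * by (force simp: M_def le_max_iff_disj)+
  define K where "K = (M + B * M) * M * M"
  \<comment> \<open>The first summand is the variation of the potential over the ball, from its
    Lipschitz constant \<open>K\<close>; the second bounds its value at the zero matrix.\<close>
  define P where "P = (M + B * M) * M * M * B + (M * M * M)"
  have K0: "0 \<le> K" and P0: "0 \<le> P"
    using M0 \<open>0 \<le> B\<close> by (simp_all add: K_def P_def)
  have pot: "potential (E t) (W t) R (U t) \<in> {0..P}" if t: "t \<in> S" and R: "norm R \<le> B" for t R
  proof -
    have "\<bar>potential (E t) (W t) R (U t) - potential (E t) (W t) 0 (U t)\<bar>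
        \<le> (M + B * M) * M * M * norm (R - 0)"
      using M[OF t] R \<open>0 \<le> B\<close> by (intro potential_diff_le) auto
    also have "\<dots> \<le> (M + B * M) * M * M * B"
      using M0 \<open>0 \<le> B\<close> R by (intro mult_left_mono) auto
    finally have 1: "potential (E t) (W t) R (U t)
        \<le> (M + B * M) * M * M * B + potential (E t) (W t) 0 (U t)"
      by linarith
    have "E t \<bullet> (E t ** W t) \<le> norm (E t) * (norm (E t) * norm (W t))"
      by (intro order_trans[OF norm_cauchy_schwarz] mult_left_mono norm_matrix_mult_le) auto
    also have "\<dots> \<le> M * (M * M)"
      using M[OF t] M0 by (intro mult_mono) auto
    finally have "E t \<bullet> (E t ** W t) \<le> M * M * M"
      by (simp add: mult.assoc)
    moreover have "potential (E t) (W t) 0 (U t) = 1 / 2 * (E t \<bullet> (E t ** W t))"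
      by (simp add: potential_def mat_inner_eq_inner
          bounded_bilinear.zero_left[OF bounded_bilinear_matrix_mult])
    moreover have "0 \<le> M * M * M"
      using M0 by simp
    ultimately have "potential (E t) (W t) 0 (U t) \<le> M * M * M"
      by linarith
    with 1 potential_nonneg[OF W[OF t]] show ?thesis
      by (simp add: P_def)
  qed
  obtain C where C0: "0 \<le> C" and C: "\<And>x. x \<in> {0..P} \<Longrightarrow> \<bar>\<phi> x\<bar> \<le> C"
    "\<And>x y. x \<in> {0..P} \<Longrightarrow> y \<in> {0..P} \<Longrightarrow> \<bar>\<phi> x - \<phi> y\<bar> \<le> C * \<bar>x - y\<bar>"
    using gain_derivative_bounds[OF gain P0] by blast
  let ?L = "\<lambda>t. E t ** W t ** transpose (U t)"
  have L: "norm (?L t) \<le> M * M * M" if "t \<in> S" for t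
  proof -
    have "norm (?L t) \<le> norm (E t) * norm (W t) * norm (U t)"
      using norm_matrix_mult_le[of "E t ** W t" "transpose (U t)"] norm_matrix_mult_le[of "E t" "W t"]
      by (smt (verit) mult_right_mono norm_ge_zero norm_transpose)
    also have "\<dots> \<le> M * M * M"
      using M[OF that] M0 by (intro mult_mono) auto
    finally show ?thesis .
  qed
  have inn: "norm (innovation (?L t) R) \<le> 2 * (M * M * M) * norm R" if "t \<in> S" for t R
    using norm_innovation_le[of "?L t" R] L[OF that]
    by (smt (verit) mult_left_mono mult_right_mono norm_ge_zero)
  define I where "I = 2 * (M * M * M)"
  have I0: "0 \<le> I"
    using M0 by (simp add: I_def)
  have innB: "norm (innovation (?L t) R) \<le> I * B" if "t \<in> S" "norm R \<le> B" for t R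
    using inn[OF that(1), of R] mult_left_mono[OF that(2) I0] by (simp add: I_def)
  show thesis
  proof (rule that[of "C * (I * B) + (C * K * (I * B) + C * I)"])
    fix t and R :: "real^3^3"
    assume t: "t \<in> S" and R: "norm R \<le> B"
    have "norm (feedback \<phi> E W U t R) \<le> C * (I * B)"
      unfolding feedback_def norm_scaleR
      using C(1)[OF pot[OF t R]] innB[OF t R] C0 by (intro mult_mono) auto
    then show "norm (feedback \<phi> E W U t R) \<le> C * (I * B) + (C * K * (I * B) + C * I)"
      using C0 K0 I0 \<open>0 \<le> B\<close> by (simp add: add_increasing2)
    fix R' :: "real^3^3"
    assume R': "norm R' \<le> B"
    let ?p = "potential (E t) (W t) R (U t)" and ?q = "potential (E t) (W t) R' (U t)"
    have "feedback \<phi> E W U t R - feedback \<phi> E W U t R'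
        = (\<phi> ?p - \<phi> ?q) *\<^sub>R innovation (?L t) R + \<phi> ?q *\<^sub>R innovation (?L t) (R - R')"
      by (simp add: feedback_def innovation_diff[symmetric] algebra_simps)
    then have "norm (feedback \<phi> E W U t R - feedback \<phi> E W U t R')
        \<le> \<bar>\<phi> ?p - \<phi> ?q\<bar> * norm (innovation (?L t) R) + \<bar>\<phi> ?q\<bar> * norm (innovation (?L t) (R - R'))"
      by (metis norm_scaleR norm_triangle_ineq real_norm_def)
    also have "\<dots> \<le> (C * (K * norm (R - R'))) * (I * B) + C * (I * norm (R - R'))"
    proof (intro add_mono mult_mono C(1) pot innB t R R')
      show "\<bar>\<phi> ?p - \<phi> ?q\<bar> \<le> C * (K * norm (R - R'))"
        using C(2)[OF pot[OF t R] pot[OF t R']] potential_diff_le[OF M[OF t] R R'] C0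
        unfolding K_def by (smt (verit) mult_left_mono)
      show "norm (innovation (?L t) (R - R')) \<le> I * norm (R - R')"
        using inn[OF t] by (simp add: I_def)
    qed (use C0 K0 I0 in auto)
    also have "\<dots> = (C * K * (I * B) + C * I) * norm (R - R')"
      by (simp add: algebra_simps)
    also have "\<dots> \<le> (C * (I * B) + (C * K * (I * B) + C * I)) * norm (R - R')"
      using C0 K0 I0 \<open>0 \<le> B\<close> by (intro mult_right_mono) auto
    finally show "norm (feedback \<phi> E W U t R - feedback \<phi> E W U t R')
        \<le> (C * (I * B) + (C * K * (I * B) + C * I)) * norm (R - R')" .
  qed (use C0 K0 I0 \<open>0 \<le> B\<close> in auto)
qed

section \<open>Taylor bounds\<close>

text \<open>The mean value inequality is applied to f minus its tangent at x, on the interval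
  between x and y in either order. The backward case y < x is the one behind the trapezoidal
  bound.\<close>

lemma taylor_first_order:
  fixes f :: "real \<Rightarrow> 'a::real_normed_vector"
  assumes d: "\<And>t. t \<in> {a..b} \<Longrightarrow> (f has_vector_derivative f' t) (at t within {a..b})"
    and lip: "\<And>s t. s \<in> {a..b} \<Longrightarrow> t \<in> {a..b} \<Longrightarrow> norm (f' s - f' t) \<le> L * \<bar>s - t\<bar>" and "0 \<le> L"
    and xy: "x \<in> {a..b}" "y \<in> {a..b}"
  shows "norm (f y - (f x + (y - x) *\<^sub>R f' x)) \<le> L * (y - x)\<^sup>2"
proof -
  let ?I = "{min x y..max x y}"
  have sub: "?I \<subseteq> {a..b}"
    using xy by auto
  have "norm ((f y - y *\<^sub>R f' x) - (f x - x *\<^sub>R f' x)) \<le> (L * \<bar>y - x\<bar>) * \<bar>y - x\<bar>"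
  proof (rule vector_mean_value[where a = "min x y" and b = "max x y"])
    fix t assume t: "t \<in> ?I"
    then have t': "t \<in> {a..b}"
      using sub by blast
    show "((\<lambda>t. f t - t *\<^sub>R f' x) has_vector_derivative (f' t - f' x)) (at t within ?I)"
      by (rule has_vector_derivative_within_subset[OF _ sub])
        (auto intro!: derivative_eq_intros d t')
    have "norm (f' t - f' x) \<le> L * \<bar>t - x\<bar>"
      by (rule lip[OF t' xy(1)])
    also have "\<dots> \<le> L * \<bar>y - x\<bar>"
      using t \<open>0 \<le> L\<close> by (intro mult_left_mono) auto
    finally show "norm (f' t - f' x) \<le> L * \<bar>y - x\<bar>" .
  qed auto
  then show ?thesis
    by (simp add: algebra_simps power2_eq_square abs_mult_self_eq)
qed

text \<open>The derivative \<open>f'\<close> is prescribed by the caller, as the right-hand side of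
  a differential equation, and identified by uniqueness with the one hidden in \<open>Cn_on\<close>;
  the bounds thus apply to that right-hand side.\<close>

lemma C3_bounds:
  fixes f :: "real \<Rightarrow> 'a::real_normed_vector"
  assumes "a < b" and C3: "Cn_on 3 f {a..b}"
    and d: "\<And>t. t \<in> {a..b} \<Longrightarrow> (f has_vector_derivative f' t) (at t within {a..b})"
  obtains K where "0 \<le> K"
    "\<And>t. t \<in> {a..b} \<Longrightarrow> norm (f t) \<le> K" "\<And>t. t \<in> {a..b} \<Longrightarrow> norm (f' t) \<le> K"
    "\<And>s t. s \<in> {a..b} \<Longrightarrow> t \<in> {a..b} \<Longrightarrow> norm (f s - f t) \<le> K * \<bar>s - t\<bar>"
    "\<And>s t. s \<in> {a..b} \<Longrightarrow> t \<in> {a..b} \<Longrightarrow> norm (f' s - f' t) \<le> K * \<bar>s - t\<bar>"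
    "\<And>t h. a \<le> t \<Longrightarrow> 0 \<le> h \<Longrightarrow> t + h \<le> b \<Longrightarrow>
       norm (f (t + h) - (f t + h *\<^sub>R f' t)) \<le> K * h\<^sup>2"
    "\<And>t h. a \<le> t \<Longrightarrow> 0 \<le> h \<Longrightarrow> t + h \<le> b \<Longrightarrow>
       norm (f (t + h) - (f t + (h / 2) *\<^sub>R (f' t + f' (t + h)))) \<le> K * h ^ 3"
proof -
  let ?I = "{a..b}"
  obtain g1 f2 f3 where g1: "\<And>t. t \<in> ?I \<Longrightarrow> (f has_vector_derivative g1 t) (at t within ?I)"
    and g2: "\<And>t. t \<in> ?I \<Longrightarrow> (g1 has_vector_derivative f2 t) (at t within ?I)"
    and d3: "\<And>t. t \<in> ?I \<Longrightarrow> (f2 has_vector_derivative f3 t) (at t within ?I)"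
    and c3: "continuous_on ?I f3"
    using C3 unfolding numeral_3_eq_3 Cn_on.simps by metis
  have eq: "g1 t = f' t" if "t \<in> ?I" for t
    using vector_derivative_unique_within_closed_interval[of a b t f "g1 t" "f' t"]
      \<open>a < b\<close> that g1[OF that] d[OF that] by simp
  have d2: "(f' has_vector_derivative f2 t) (at t within ?I)" if "t \<in> ?I" for t
    using has_vector_derivative_transform[OF that _ g2[OF that], of f'] eq by simp
  have bdd: "\<exists>C. \<forall>t\<in>?I. norm (g t) \<le> C" if "continuous_on ?I g" for g :: "real \<Rightarrow> 'a"
    using compact_imp_bounded[OF compact_continuous_image[OF that compact_Icc]]
    by (auto simp: bounded_iff)
  obtain C0 C1 C2 C3 where
    C: "\<And>t. t \<in> ?I \<Longrightarrow> norm (f t) \<le> C0" "\<And>t. t \<in> ?I \<Longrightarrow> norm (f' t) \<le> C1"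
      "\<And>t. t \<in> ?I \<Longrightarrow> norm (f2 t) \<le> C2" "\<And>t. t \<in> ?I \<Longrightarrow> norm (f3 t) \<le> C3"
    using bdd[OF continuous_on_vector_derivative[OF d]] bdd[OF continuous_on_vector_derivative[OF d2]]
      bdd[OF continuous_on_vector_derivative[OF d3]] bdd[OF c3] by metis
  define K where "K = max C0 (max C1 (max C2 C3))"
  have K: "norm (f t) \<le> K" "norm (f' t) \<le> K" "norm (f2 t) \<le> K" "norm (f3 t) \<le> K" if "t \<in> ?I" for t
    using C[OF that] by (auto simp: K_def)
  have K0: "0 \<le> K"
    using order_trans[OF norm_ge_zero K(1)[of a]] \<open>a < b\<close> by simp
  have L: "norm (f s - f t) \<le> K * \<bar>s - t\<bar>" "norm (f' s - f' t) \<le> K * \<bar>s - t\<bar>"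
    "norm (f2 s - f2 t) \<le> K * \<bar>s - t\<bar>" if "s \<in> ?I" "t \<in> ?I" for s t
    using vector_mean_value[OF d K(2) that] vector_mean_value[OF d2 K(3) that]
      vector_mean_value[OF d3 K(4) that] by auto
  show thesis
  proof (rule that[OF K0 K(1) K(2) L(1) L(2)])
    fix t h assume th: "a \<le> t" "0 \<le> h" "t + h \<le> b"
    show "norm (f (t + h) - (f t + h *\<^sub>R f' t)) \<le> K * h\<^sup>2"
      using taylor_first_order[OF d L(2) K0, of t "t + h"] th by simp
    let ?J = "{t..t + h}"
    have sub: "?J \<subseteq> ?I"
      using th by auto
    \<comment> \<open>The trapezoidal error as a function of the right end point. Its derivative is
      -1/2 times the remainder of \<open>f'\<close> expanded at s and evaluated at t, hence of order
      h^2; the length of the step supplies the third power.\<close>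
    let ?g = "\<lambda>s. f s - (f t + ((s - t) / 2) *\<^sub>R (f' t + f' s))"
    have "norm (?g (t + h) - ?g t) \<le> (K * h\<^sup>2) * \<bar>t + h - t\<bar>"
    proof (rule vector_mean_value[where a = t and b = "t + h"])
      fix s assume s: "s \<in> ?J"
      then have s': "s \<in> ?I" and t': "t \<in> ?I"
        using th by auto
      show "(?g has_vector_derivative (f' s - (((s - t) / 2) *\<^sub>R f2 s + (1 / 2) *\<^sub>R (f' t + f' s)))) (at s within ?J)"
        by (rule has_vector_derivative_within_subset[OF _ sub])
          (auto intro!: derivative_eq_intros d[OF s'] d2[OF s'])
      have "f' s - (((s - t) / 2) *\<^sub>R f2 s + (1 / 2) *\<^sub>R (f' t + f' s))
          = - (1 / 2) *\<^sub>R (f' t - (f' s + (t - s) *\<^sub>R f2 s))"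
      proof -
        have "f' s - (((s - t) / 2) *\<^sub>R f2 s + (1 / 2) *\<^sub>R (f' t + f' s))
            = (f' s - (1 / 2) *\<^sub>R f' s) - (((s - t) / 2) *\<^sub>R f2 s + (1 / 2) *\<^sub>R f' t)"
          by (simp add: scaleR_right_distrib)
        also have "f' s - (1 / 2) *\<^sub>R f' s = (1 / 2) *\<^sub>R f' s"
          using scaleR_left_diff_distrib[of 1 "1 / 2" "f' s"] by simp
        also have "(1 / 2) *\<^sub>R f' s - (((s - t) / 2) *\<^sub>R f2 s + (1 / 2) *\<^sub>R f' t)
            = - (1 / 2) *\<^sub>R (f' t - (f' s + (t - s) *\<^sub>R f2 s))"
          by (simp add: algebra_simps diff_divide_distrib)
        finally show ?thesis .
      qed
      then have "norm (f' s - (((s - t) / 2) *\<^sub>R f2 s + (1 / 2) *\<^sub>R (f' t + f' s)))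
          = 1 / 2 * norm (f' t - (f' s + (t - s) *\<^sub>R f2 s))"
        by (simp only: norm_scaleR)
      also have "\<dots> \<le> norm (f' t - (f' s + (t - s) *\<^sub>R f2 s))"
        by simp
      also have "\<dots> \<le> K * (t - s)\<^sup>2"
        by (rule taylor_first_order[OF d2 L(3) K0 s' t'])
      also have "\<dots> \<le> K * h\<^sup>2"
        using s K0 th by (intro mult_left_mono) (auto simp: abs_le_square_iff[symmetric])
      finally show "norm (f' s - (((s - t) / 2) *\<^sub>R f2 s + (1 / 2) *\<^sub>R (f' t + f' s))) \<le> K * h\<^sup>2" .
    qed (use th in auto)
    then show "norm (f (t + h) - (f t + (h / 2) *\<^sub>R (f' t + f' (t + h)))) \<le> K * h ^ 3"
      using th by (simp add: power2_eq_square power3_eq_cube mult.assoc)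
  qed
qed

section \<open>Uniform domination\<close>

text \<open>A big-O with one constant on a whole set and no limit process: uniformity in time, step
  size and starting point is built in, since the index may run over complete numerical
  steps.\<close>

definition dominated :: "'x set \<Rightarrow> ('x \<Rightarrow> 'a::real_normed_vector) \<Rightarrow> ('x \<Rightarrow> real) \<Rightarrow> bool" where
  "dominated X f g \<longleftrightarrow> (\<exists>C\<ge>0. \<forall>x\<in>X. norm (f x) \<le> C * g x)"

lemma dominatedI:
  assumes "0 \<le> C" "\<And>x. x \<in> X \<Longrightarrow> norm (f x) \<le> C * g x"
  shows "dominated X f g"
  using assms by (auto simp: dominated_def)

lemma dominatedE:
  assumes "dominated X f g"
  obtains C where "0 \<le> C" "\<And>x. x \<in> X \<Longrightarrow> norm (f x) \<le> C * g x"
  using assms by (auto simp: dominated_def)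

lemma dominated_cong:
  assumes "dominated X f g" "\<And>x. x \<in> X \<Longrightarrow> f' x = f x"
  shows "dominated X f' g"
  using assms by (simp add: dominated_def)

lemma dominated_mono:
  assumes "dominated X f g" "0 \<le> K" "\<And>x. x \<in> X \<Longrightarrow> g x \<le> K * g' x"
  shows "dominated X f g'"
proof -
  obtain C where "0 \<le> C" and C: "\<And>x. x \<in> X \<Longrightarrow> norm (f x) \<le> C * g x"
    using assms(1) by (rule dominatedE) blast
  show ?thesis
  proof (rule dominatedI[of "C * K"])
    show "norm (f x) \<le> C * K * g' x" if "x \<in> X" for x
      using C[OF that] mult_left_mono[OF assms(3)[OF that] \<open>0 \<le> C\<close>] by (simp add: mult.assoc)
  qed (use \<open>0 \<le> C\<close> assms(2) in simp)
qed

lemma dominated_add: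
  assumes "dominated X f g" "dominated X f' g"
  shows "dominated X (\<lambda>x. f x + f' x) g"
proof -
  obtain C C' where "0 \<le> C" "0 \<le> C'" and C: "\<And>x. x \<in> X \<Longrightarrow> norm (f x) \<le> C * g x"
      "\<And>x. x \<in> X \<Longrightarrow> norm (f' x) \<le> C' * g x"
    using assms unfolding dominated_def by blast
  show ?thesis
  proof (rule dominatedI[of "C + C'"])
    show "norm (f x + f' x) \<le> (C + C') * g x" if "x \<in> X" for x
      using norm_triangle_mono[OF C(1)[OF that] C(2)[OF that]] by (simp add: distrib_right)
  qed (use \<open>0 \<le> C\<close> \<open>0 \<le> C'\<close> in simp)
qed

lemma dominated_uminus: "dominated X f g \<Longrightarrow> dominated X (\<lambda>x. - f x) g"
  by (simp add: dominated_def)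

lemma dominated_diff:
  assumes "dominated X f g" "dominated X f' g"
  shows "dominated X (\<lambda>x. f x - f' x) g"
  using dominated_add[OF assms(1) dominated_uminus[OF assms(2)]] by simp

lemma dominated_bilinear:
  assumes "bounded_bilinear B" "dominated X f g" "dominated X f' g'"
  shows "dominated X (\<lambda>x. B (f x) (f' x)) (\<lambda>x. g x * g' x)"
proof -
  obtain C C' where "0 \<le> C" "0 \<le> C'" and C: "\<And>x. x \<in> X \<Longrightarrow> norm (f x) \<le> C * g x"
      "\<And>x. x \<in> X \<Longrightarrow> norm (f' x) \<le> C' * g' x"
    using assms(2,3) unfolding dominated_def by blast
  obtain K where "0 \<le> K" and K: "\<And>u v. norm (B u v) \<le> norm u * norm v * K"
    using bounded_bilinear.nonneg_bounded[OF assms(1)] by blast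
  show ?thesis
  proof (rule dominatedI[of "C * C' * K"])
    fix x assume x: "x \<in> X"
    have "norm (B (f x) (f' x)) \<le> norm (f x) * norm (f' x) * K"
      by (rule K)
    also have "\<dots> \<le> (C * g x) * (C' * g' x) * K"
      using C(1)[OF x] C(2)[OF x] \<open>0 \<le> K\<close> order_trans[OF norm_ge_zero C(1)[OF x]]
      by (intro mult_right_mono mult_mono) auto
    finally show "norm (B (f x) (f' x)) \<le> C * C' * K * (g x * g' x)"
      by (simp add: mult_ac)
  qed (use \<open>0 \<le> C\<close> \<open>0 \<le> C'\<close> \<open>0 \<le> K\<close> in simp)
qed

lemma dominated_bilinear_bounded_left:
  assumes "bounded_bilinear B" "dominated X f (\<lambda>_. 1)" "dominated X f' g"
  shows "dominated X (\<lambda>x. B (f x) (f' x)) g"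
  using dominated_bilinear[OF assms] by simp

lemma dominated_bilinear_bounded_right:
  assumes "bounded_bilinear B" "dominated X f g" "dominated X f' (\<lambda>_. 1)"
  shows "dominated X (\<lambda>x. B (f x) (f' x)) g"
  using dominated_bilinear[OF assms] by simp

text \<open>The splitting B(u, v) - B(u', v') = B(u, v - v') + B(u - u', v') is why boundedness is
  asked of \<open>u\<close> and \<open>v'\<close>.\<close>

lemma dominated_bilinear_diff:
  assumes B: "bounded_bilinear B"
    and "dominated X (\<lambda>x. u x - u' x) g" "dominated X (\<lambda>x. v x - v' x) g"
    and "dominated X u (\<lambda>_. 1)" "dominated X v' (\<lambda>_. 1)"
  shows "dominated X (\<lambda>x. B (u x) (v x) - B (u' x) (v' x)) g"
proof (rule dominated_cong)
  show "dominated X (\<lambda>x. B (u x) (v x - v' x) + B (u x - u' x) (v' x)) g"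
    using assms by (intro dominated_add dominated_bilinear_bounded_left[OF B]
      dominated_bilinear_bounded_right[OF B])
qed (simp add: bounded_bilinear.diff_left[OF B] bounded_bilinear.diff_right[OF B])

lemma dominated_scaleR: "dominated X f g \<Longrightarrow> dominated X (\<lambda>x. c *\<^sub>R f x) g"
  by (rule dominated_bilinear_bounded_left[OF bounded_bilinear_scaleR])
    (auto intro: dominatedI[of "\<bar>c\<bar>"])

lemma dominated_matrix_vector: "dominated X f g \<Longrightarrow> dominated X (\<lambda>x. A *v f x) g"
  for A :: "real^'n^'m"
  by (rule dominated_bilinear_bounded_left[OF bounded_bilinear_matrix_vector_mult])
    (auto intro: dominatedI[of "norm A"])

section \<open>One step of the filter\<close>

abbreviation rot :: "real^3^3 \<Rightarrow> real^3 \<Rightarrow> real^3^3" where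
  "rot R a \<equiv> R ** skew a"

lemma bounded_bilinear_rot: "bounded_bilinear rot"
  using bounded_bilinear.comp[OF bounded_bilinear_matrix_mult bounded_linear_ident bounded_linear_skew] .

lemmas rot_simps = bounded_bilinear.add_left[OF bounded_bilinear_rot] bounded_bilinear.add_right[OF bounded_bilinear_rot]
  bounded_bilinear.diff_left[OF bounded_bilinear_rot] bounded_bilinear.diff_right[OF bounded_bilinear_rot]
  bounded_bilinear.minus_left[OF bounded_bilinear_rot] bounded_bilinear.minus_right[OF bounded_bilinear_rot]
  bounded_bilinear.scaleR_left[OF bounded_bilinear_rot] bounded_bilinear.scaleR_right[OF bounded_bilinear_rot]

lemmas cross_simps = bounded_bilinear.add_left[OF bounded_bilinear_cross3] bounded_bilinear.add_right[OF bounded_bilinear_cross3]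
  bounded_bilinear.diff_left[OF bounded_bilinear_cross3] bounded_bilinear.diff_right[OF bounded_bilinear_cross3]
  bounded_bilinear.minus_left[OF bounded_bilinear_cross3] bounded_bilinear.minus_right[OF bounded_bilinear_cross3]
  bounded_bilinear.scaleR_left[OF bounded_bilinear_cross3] bounded_bilinear.scaleR_right[OF bounded_bilinear_cross3]

lemmas matvec_simps = matrix_vector_right_distrib matrix_vector_mult_diff_distrib matrix_vector_mult_scaleR
  bounded_bilinear.minus_right[OF bounded_bilinear_matrix_vector_mult]

text \<open>Normalised vector identities are checked componentwise, where they become real ones.\<close>

lemmas vec_simps = vec_eq_iff vector_add_component vector_minus_component vector_uminus_component
  vector_scaleR_component

text \<open>The gauge \<open>e\<close> merges starting errors with truncation terms of size h^2. Its
  boundedness turns O(e) perturbations of bounded quantities into bounded quantities. It is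
  interpreted twice, without and with the velocity error at the end of the step.\<close>

locale step_gauge =
  fixes X :: "'x set" and h e :: "'x \<Rightarrow> real"
  assumes h_pos: "x \<in> X \<Longrightarrow> 0 < h x" and h_le: "x \<in> X \<Longrightarrow> h x \<le> 1"
    and h2_le_e: "x \<in> X \<Longrightarrow> (h x)\<^sup>2 \<le> e x" and e_bounded: "dominated X e (\<lambda>_. 1)"
begin

abbreviation BigO :: "('x \<Rightarrow> 'b::real_normed_vector) \<Rightarrow> ('x \<Rightarrow> real) \<Rightarrow> bool" where
  "BigO \<equiv> dominated X"

section \<open>Calculus of orders in the step size and the gauge\<close>

lemma h_nonneg: "x \<in> X \<Longrightarrow> 0 \<le> h x"
  using h_pos less_imp_le by blast

lemma abs_h_le_1: "x \<in> X \<Longrightarrow> \<bar>h x\<bar> \<le> 1"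
  using h_pos h_le by fastforce

lemma O_h_self: "BigO h h"
  by (intro dominatedI[of 1]) (auto simp: h_nonneg)

lemma O_h_pow: "BigO (\<lambda>x. h x ^ k) (\<lambda>x. h x ^ k)"
  by (intro dominatedI[of 1]) (auto simp: h_nonneg)

lemma O_le: "BigO f g \<Longrightarrow> (\<And>x. x \<in> X \<Longrightarrow> g x \<le> g' x) \<Longrightarrow> BigO f g'"
  by (rule dominated_mono[of X f g 1]) auto

lemma O_h_1: "BigO f h \<Longrightarrow> BigO f (\<lambda>_. 1)"
  by (erule O_le) (rule h_le)

lemma O_h2_h: "BigO f (\<lambda>x. (h x)\<^sup>2) \<Longrightarrow> BigO f h"
  using h_pos h_le by (elim O_le) (simp add: power2_eq_square mult_left_le)

lemma O_h2_e: "BigO f (\<lambda>x. (h x)\<^sup>2) \<Longrightarrow> BigO f e"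
  by (erule O_le) (rule h2_le_e)

lemma O_h3_h2: "BigO f (\<lambda>x. h x ^ 3) \<Longrightarrow> BigO f (\<lambda>x. (h x)\<^sup>2)"
  by (elim O_le) (auto intro: power_decreasing h_nonneg h_le)

lemma O_h3_he: "BigO f (\<lambda>x. h x ^ 3) \<Longrightarrow> BigO f (\<lambda>x. h x * e x)"
  using h_pos h2_le_e by (elim O_le) (auto simp: power3_eq_cube power2_eq_square mult.assoc)

lemma O_e_1: "BigO f e \<Longrightarrow> BigO f (\<lambda>_. 1)"
proof -
  assume f: "BigO f e"
  obtain C where "0 \<le> C" "\<And>x. x \<in> X \<Longrightarrow> norm (e x) \<le> C * 1"
    using e_bounded by (rule dominatedE) blast
  then show ?thesis
    by (intro dominated_mono[OF f, of C]) (auto intro: order_trans[OF abs_ge_self])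
qed

text \<open>Scalars are kept in the shape \<open>h x * c\<close> or
  \<open>(h x)\<^sup>2 * c\<close>, even for c = 1, so that resolution can read off the power of
  h.\<close>

lemma O_scale_h: "BigO f g \<Longrightarrow> BigO (\<lambda>x. (h x * c) *\<^sub>R f x) (\<lambda>x. h x * g x)"
  using dominated_bilinear[OF bounded_bilinear_scaleR, of X "\<lambda>x. h x * c" h f g]
    dominated_scaleR[OF O_h_self, of c] by (simp add: mult.commute)

lemma O_scale_h2: "BigO f g \<Longrightarrow> BigO (\<lambda>x. ((h x)\<^sup>2 * c) *\<^sub>R f x) (\<lambda>x. (h x)\<^sup>2 * g x)"
  using dominated_bilinear[OF bounded_bilinear_scaleR, of X "\<lambda>x. (h x)\<^sup>2 * c" "\<lambda>x. (h x)\<^sup>2" f g]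
    dominated_scaleR[OF O_h_pow[of 2], of c] by (simp add: mult.commute)

lemma O_scale_h2_1: "BigO f (\<lambda>_. 1) \<Longrightarrow> BigO (\<lambda>x. ((h x)\<^sup>2 * c) *\<^sub>R f x) (\<lambda>x. (h x)\<^sup>2)"
  using O_scale_h2[of f "\<lambda>_. 1"] by simp

lemma O_scale_h_h2: "BigO f (\<lambda>x. (h x)\<^sup>2) \<Longrightarrow> BigO (\<lambda>x. (h x * c) *\<^sub>R f x) (\<lambda>x. h x ^ 3)"
  using O_scale_h[of f "\<lambda>x. (h x)\<^sup>2"] by (simp add: power2_eq_square power3_eq_cube mult.assoc)

lemma O_scale_h2_h: "BigO f h \<Longrightarrow> BigO (\<lambda>x. ((h x)\<^sup>2 * c) *\<^sub>R f x) (\<lambda>x. h x ^ 3)"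
  using O_scale_h2[of f h] by (simp add: power2_eq_square power3_eq_cube mult.assoc)

lemma O_scale_le: "BigO f (\<lambda>x. g x) \<Longrightarrow> (\<And>x. x \<in> X \<Longrightarrow> \<bar>c x\<bar> \<le> 1) \<Longrightarrow> BigO (\<lambda>x. c x *\<^sub>R f x) g"
  by (rule dominated_bilinear_bounded_left[OF bounded_bilinear_scaleR])
    (auto intro: dominatedI[of 1])

lemma h2_le_1: "x \<in> X \<Longrightarrow> \<bar>(h x)\<^sup>2\<bar> \<le> 1"
  using h_pos h_le by (auto simp: power_le_one less_imp_le)

lemma O_cross: "BigO a (\<lambda>_. 1) \<Longrightarrow> BigO v g \<Longrightarrow> BigO (\<lambda>x. cross3 (a x) (v x)) g"
  by (rule dominated_bilinear_bounded_left[OF bounded_bilinear_cross3])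

lemma O_rot: "BigO R (\<lambda>_. 1) \<Longrightarrow> BigO a g \<Longrightarrow> BigO (\<lambda>x. rot (R x) (a x)) g"
  by (rule dominated_bilinear_bounded_left[OF bounded_bilinear_rot])

lemma O_rot': "BigO R g \<Longrightarrow> BigO a (\<lambda>_. 1) \<Longrightarrow> BigO (\<lambda>x. rot (R x) (a x)) g"
  by (rule dominated_bilinear_bounded_right[OF bounded_bilinear_rot])

lemma O_mat_exp_skew:
  assumes "BigO a (\<lambda>_. 1)"
  shows "BigO (\<lambda>x. mat_exp (h x *\<^sub>R skew (a x)) - (mat 1 + h x *\<^sub>R skew (a x)
    + ((h x)\<^sup>2 * (1 / 2)) *\<^sub>R (skew (a x) ** skew (a x)))) (\<lambda>x. h x ^ 3)"
proof -
  let ?I = "norm (mat 1 :: real^3^3)"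
  have "BigO (\<lambda>_. mat 1 :: real^3^3) (\<lambda>_. 1)"
    by (rule dominatedI[of ?I]) auto
  then have "BigO (\<lambda>x. skew (a x)) (\<lambda>_. 1)"
    using dominated_bilinear_bounded_left[OF bounded_bilinear_rot, of X "\<lambda>_. mat 1" a "\<lambda>_. 1"] assms
    by simp
  then obtain C where "0 \<le> C" and C: "\<And>x. x \<in> X \<Longrightarrow> norm (skew (a x)) \<le> C * 1"
    by (rule dominatedE) blast
  show ?thesis
  proof (rule dominatedI[of "?I * exp C * C ^ 3"])
    fix x assume x: "x \<in> X"
    let ?A = "h x *\<^sub>R skew (a x)"
    have A: "norm ?A \<le> h x * C"
      using C[OF x] h_pos[OF x] by (simp add: mult_left_mono)
    also have "h x * C \<le> C"
      using h_le[OF x] \<open>0 \<le> C\<close> by (simp add: mult_left_le_one_le mult_right_le_one_le h_pos[OF x] less_imp_le)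
    finally have A': "norm ?A \<le> C" .
    have "norm (mat_exp ?A - (mat 1 + ?A + (1/2) *\<^sub>R (?A ** ?A))) \<le> ?I * exp (norm ?A) * norm ?A ^ 3"
      by (rule mat_exp_remainder_le)
    also have "\<dots> \<le> ?I * exp C * (h x * C) ^ 3"
      using A A' by (intro mult_mono power_mono) auto
    also have "(1/2) *\<^sub>R (?A ** ?A) = ((h x)\<^sup>2 * (1 / 2)) *\<^sub>R (skew (a x) ** skew (a x))"
      by (simp add: scaleR_matrix_mult matrix_mult_scaleR power2_eq_square)
    finally show "norm (mat_exp (h x *\<^sub>R skew (a x)) - (mat 1 + h x *\<^sub>R skew (a x)
        + ((h x)\<^sup>2 * (1 / 2)) *\<^sub>R (skew (a x) ** skew (a x)))) \<le> ?I * exp C * C ^ 3 * h x ^ 3"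
      by (simp add: power_mult_distrib mult_ac)
  qed (use \<open>0 \<le> C\<close> in simp)
qed

lemma O_mat_exp_skew_vector:
  assumes "BigO a (\<lambda>_. 1)" "BigO v (\<lambda>_. 1)"
  shows "BigO (\<lambda>x. mat_exp (h x *\<^sub>R skew (a x)) *v v x - (v x + h x *\<^sub>R cross3 (a x) (v x)
    + ((h x)\<^sup>2 * (1 / 2)) *\<^sub>R cross3 (a x) (cross3 (a x) (v x)))) (\<lambda>x. h x ^ 3)"
  by (rule dominated_cong[OF dominated_bilinear_bounded_right[OF
        bounded_bilinear_matrix_vector_mult O_mat_exp_skew[OF assms(1)] assms(2)]])
    (simp add: matrix_vector_mult_add_rdistrib matrix_vector_mult_diff_rdistrib
      scaleR_matrix_vector_assoc[symmetric] matrix_vector_mul_assoc[symmetric])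

lemma O_mat_exp_skew_matrix:
  assumes "BigO a (\<lambda>_. 1)" "BigO R (\<lambda>_. 1)"
  shows "BigO (\<lambda>x. R x ** mat_exp (h x *\<^sub>R skew (a x)) - (R x + h x *\<^sub>R rot (R x) (a x)
    + ((h x)\<^sup>2 * (1 / 2)) *\<^sub>R rot (rot (R x) (a x)) (a x))) (\<lambda>x. h x ^ 3)"
  by (rule dominated_cong[OF dominated_bilinear_bounded_left[OF
        bounded_bilinear_matrix_mult assms(2) O_mat_exp_skew[OF assms(1)]]])
    (simp add: bounded_bilinear.diff_right[OF bounded_bilinear_matrix_mult] matrix_add_ldistrib
      matrix_mult_scaleR matrix_mul_assoc)

text \<open>In the trapezoidal rule for R' the end value \<open>r1\<close> is replaced by its Euler
  step, which produces the term h^2/2 \<open>rot (rot r s) s1\<close>. The midpoint estimate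
  \<open>a\<close> may then take the place of \<open>s\<close> and \<open>s1\<close>: their mean
  differs from it by O(h^2), and in the quadratic term a difference of O(h) is enough.\<close>

lemma exact_attitude:
  assumes trap: "BigO (\<lambda>x. r1 x - (r x + (h x / 2) *\<^sub>R (rot (r x) (s x) + rot (r1 x) (s1 x)))) (\<lambda>x. h x ^ 3)"
    and euler: "BigO (\<lambda>x. r1 x - (r x + h x *\<^sub>R rot (r x) (s x))) (\<lambda>x. (h x)\<^sup>2)"
    and ds: "BigO (\<lambda>x. s1 x - s x) h"
    and mid: "BigO (\<lambda>x. a x - (1 / 2) *\<^sub>R (s x + s1 x)) (\<lambda>x. (h x)\<^sup>2)"
    and bnd: "BigO r (\<lambda>_. 1)" "BigO s (\<lambda>_. 1)" "BigO s1 (\<lambda>_. 1)" "BigO a (\<lambda>_. 1)"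
  shows "BigO (\<lambda>x. r1 x - (r x + h x *\<^sub>R rot (r x) (a x)
    + ((h x)\<^sup>2 * (1 / 2)) *\<^sub>R rot (rot (r x) (a x)) (a x))) (\<lambda>x. h x ^ 3)"
proof (rule dominated_cong)
  define A1 where "A1 x = r1 x - (r x + (h x / 2) *\<^sub>R (rot (r x) (s x) + rot (r1 x) (s1 x)))" for x
  define A2 where "A2 x = r1 x - (r x + h x *\<^sub>R rot (r x) (s x))" for x
  define A3 where "A3 x = s1 x - s x" for x
  define A4 where "A4 x = a x - (1 / 2) *\<^sub>R (s x + s1 x)" for x
  have A: "BigO A1 (\<lambda>x. h x ^ 3)" "BigO A2 (\<lambda>x. (h x)\<^sup>2)" "BigO A3 h" "BigO A4 (\<lambda>x. (h x)\<^sup>2)"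
    using trap euler ds mid by (simp_all add: A1_def[abs_def] A2_def[abs_def] A3_def[abs_def] A4_def[abs_def])
  \<comment> \<open>The two double products are compared through s1 - a = A3/2 - A4 and s - a =
    -A3/2 - A4, both O(h).\<close>
  show "BigO (\<lambda>x. A1 x + (h x * (1 / 2)) *\<^sub>R rot (A2 x) (s1 x) - (h x * 1) *\<^sub>R rot (r x) (A4 x)
      + ((h x)\<^sup>2 * (1 / 2)) *\<^sub>R (rot (rot (r x) (s x)) ((1 / 2) *\<^sub>R A3 x - A4 x)
          + rot (rot (r x) (- (1 / 2) *\<^sub>R A3 x - A4 x)) (a x))) (\<lambda>x. h x ^ 3)"
  proof (intro dominated_add dominated_diff A(1) O_scale_h_h2 O_scale_h2_h)
    show "BigO (\<lambda>x. rot (A2 x) (s1 x)) (\<lambda>x. (h x)\<^sup>2)" "BigO (\<lambda>x. rot (r x) (A4 x)) (\<lambda>x. (h x)\<^sup>2)"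
      by (intro O_rot' A bnd, intro O_rot A bnd)
    have A34: "BigO (\<lambda>x. c *\<^sub>R A3 x - A4 x) h" for c
      by (intro dominated_diff dominated_scaleR O_h2_h A)
    show "BigO (\<lambda>x. rot (rot (r x) (s x)) ((1 / 2) *\<^sub>R A3 x - A4 x)) h"
      by (intro O_rot A34 bnd)
    show "BigO (\<lambda>x. rot (rot (r x) (- (1 / 2) *\<^sub>R A3 x - A4 x)) (a x)) h"
      by (intro O_rot'[OF O_rot] A34 bnd)
  qed
  fix x assume "x \<in> X"
  show "r1 x - (r x + h x *\<^sub>R rot (r x) (a x) + ((h x)\<^sup>2 * (1 / 2)) *\<^sub>R rot (rot (r x) (a x)) (a x))
    = A1 x + (h x * (1 / 2)) *\<^sub>R rot (A2 x) (s1 x) - (h x * 1) *\<^sub>R rot (r x) (A4 x)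
      + ((h x)\<^sup>2 * (1 / 2)) *\<^sub>R (rot (rot (r x) (s x)) ((1 / 2) *\<^sub>R A3 x - A4 x)
          + rot (rot (r x) (- (1 / 2) *\<^sub>R A3 x - A4 x)) (a x))"
    unfolding A1_def A2_def A3_def A4_def
    by (simp only: rot_simps vec_simps) (simp add: field_simps power2_eq_square)
qed

text \<open>Numerical and exact end values have the same quadratic expansion, in (R, a') and in (r,
  a). The higher coefficients differ by O(e) and carry a factor h; the zeroth-order difference R - r
  is the propagated error, which is subtracted.\<close>

lemma attitude_step:
  assumes num: "\<And>x. x \<in> X \<Longrightarrow> R1 x = R x ** mat_exp (h x *\<^sub>R skew (a' x))"
    and exact: "BigO (\<lambda>x. r1 x - (r x + h x *\<^sub>R rot (r x) (a x)
      + ((h x)\<^sup>2 * (1 / 2)) *\<^sub>R rot (rot (r x) (a x)) (a x))) (\<lambda>x. h x ^ 3)"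
    and err: "BigO (\<lambda>x. R x - r x) e" "BigO (\<lambda>x. a' x - a x) e"
    and bnd: "BigO r (\<lambda>_. 1)" "BigO R (\<lambda>_. 1)" "BigO a (\<lambda>_. 1)" "BigO a' (\<lambda>_. 1)"
  shows "BigO (\<lambda>x. (R1 x - r1 x) - (R x - r x)) (\<lambda>x. h x * e x)"
proof (rule dominated_cong)
  let ?Y = "\<lambda>x. R x ** mat_exp (h x *\<^sub>R skew (a' x)) - (R x + h x *\<^sub>R rot (R x) (a' x)
      + ((h x)\<^sup>2 * (1 / 2)) *\<^sub>R rot (rot (R x) (a' x)) (a' x))"
  let ?Z = "\<lambda>x. r1 x - (r x + h x *\<^sub>R rot (r x) (a x)
      + ((h x)\<^sup>2 * (1 / 2)) *\<^sub>R rot (rot (r x) (a x)) (a x))"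
  have 1: "BigO (\<lambda>x. rot (R x) (a' x) - rot (r x) (a x)) e"
    by (intro dominated_bilinear_diff[OF bounded_bilinear_rot] err bnd)
  have 2: "BigO (\<lambda>x. rot (rot (R x) (a' x)) (a' x) - rot (rot (r x) (a x)) (a x)) e"
    by (intro dominated_bilinear_diff[OF bounded_bilinear_rot] err bnd O_rot)
  show "BigO (\<lambda>x. ?Y x - ?Z x + (h x * 1) *\<^sub>R (rot (R x) (a' x) - rot (r x) (a x))
      + (h x * 1) *\<^sub>R (h x *\<^sub>R ((1 / 2) *\<^sub>R (rot (rot (R x) (a' x)) (a' x) - rot (rot (r x) (a x)) (a x)))))
      (\<lambda>x. h x * e x)"
    by (intro dominated_add dominated_diff O_h3_he exact O_mat_exp_skew_matrix bnd O_scale_h 1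
        O_scale_le dominated_scaleR 2 abs_h_le_1)
qed (simp add: num algebra_simps power2_eq_square)

text \<open>The equation for the error d is tested with d itself: \<open>D\<close> being
  nonnegative, m |d|^2 \<le> d . (m d + (h/2) D d), so the inverse in the half step costs a factor
  1/m for every step size. For the defect first-order expansions suffice, as h^2 is already
  O(e).\<close>

lemma half_step_error:
  fixes m :: real and D :: "real^3^3"
  assumes "m > 0" and D: "\<And>v. 0 \<le> v \<bullet> (D *v v)"
    and num: "\<And>x. x \<in> X \<Longrightarrow> m *\<^sub>R wh x + (h x / 2) *\<^sub>R (D *v wh x)
      = mat_exp (h x *\<^sub>R skew (p' x)) *v (m *\<^sub>R w x) + (h x / 2) *\<^sub>R F' x"
    and deriv: "\<And>x. x \<in> X \<Longrightarrow> m *\<^sub>R \<eta>' x = (2 * m) *\<^sub>R cross3 (p x) (\<eta> x) + F x - D *v \<eta> x"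
    and mid: "BigO (\<lambda>x. \<eta>h x - (\<eta> x + (h x / 2) *\<^sub>R \<eta>' x)) (\<lambda>x. (h x)\<^sup>2)"
    and err: "BigO (\<lambda>x. w x - \<eta> x) e" "BigO (\<lambda>x. p' x - p x) e" "BigO (\<lambda>x. F' x - F x) e"
    and bnd: "BigO w (\<lambda>_. 1)" "BigO \<eta> (\<lambda>_. 1)" "BigO \<eta>' (\<lambda>_. 1)" "BigO p (\<lambda>_. 1)" "BigO p' (\<lambda>_. 1)"
  shows "BigO (\<lambda>x. wh x - \<eta>h x) e"
proof -
  define Z1 where "Z1 x = mat_exp (h x *\<^sub>R skew (p' x)) *v (m *\<^sub>R w x)
      - (m *\<^sub>R w x + h x *\<^sub>R cross3 (p' x) (m *\<^sub>R w x)
        + ((h x)\<^sup>2 * (1 / 2)) *\<^sub>R cross3 (p' x) (cross3 (p' x) (m *\<^sub>R w x)))" for x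
  define Z2 where "Z2 x = \<eta>h x - (\<eta> x + (h x / 2) *\<^sub>R \<eta>' x)" for x
  define d where "d x = wh x - \<eta>h x" for x
  have Z1: "BigO Z1 e"
    unfolding Z1_def by (intro O_h2_e O_h3_h2 O_mat_exp_skew_vector bnd dominated_scaleR)
  have Z2: "BigO Z2 e"
    unfolding Z2_def by (intro O_h2_e mid)
  have pw: "BigO (\<lambda>x. cross3 (p' x) (w x) - cross3 (p x) (\<eta> x)) e"
    by (intro dominated_bilinear_diff[OF bounded_bilinear_cross3] err bnd)
  have h1: "\<bar>h x\<bar> \<le> 1" "\<bar>h x / 2\<bar> \<le> 1" if "x \<in> X" for x
    using h_pos[OF that] h_le[OF that] by auto
  have "BigO (\<lambda>x. m *\<^sub>R d x + (h x / 2) *\<^sub>R (D *v d x)) e"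
  proof (rule dominated_cong)
    show "BigO (\<lambda>x. Z1 x + m *\<^sub>R (w x - \<eta> x) - m *\<^sub>R Z2 x
        + ((h x)\<^sup>2 * (m / 2)) *\<^sub>R cross3 (p' x) (cross3 (p' x) (w x))
        + (h x / 2) *\<^sub>R (F' x - F x) - ((h x)\<^sup>2 * (1 / 4)) *\<^sub>R (D *v \<eta>' x) - (h x / 2) *\<^sub>R (D *v Z2 x)
        + h x *\<^sub>R (m *\<^sub>R (cross3 (p' x) (w x) - cross3 (p x) (\<eta> x)))) e"
      by (intro dominated_add dominated_diff Z1 Z2 dominated_scaleR err O_scale_le h1 dominated_matrix_vector
          pw O_h2_e[OF O_scale_h2_1] O_cross bnd)
    fix x assume x: "x \<in> X"
    have num': "m *\<^sub>R d x + (h x / 2) *\<^sub>R (D *v d x)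
        = Z1 x + (m *\<^sub>R w x + h x *\<^sub>R cross3 (p' x) (m *\<^sub>R w x)
        + ((h x)\<^sup>2 * (1 / 2)) *\<^sub>R cross3 (p' x) (cross3 (p' x) (m *\<^sub>R w x))) + (h x / 2) *\<^sub>R F' x
        - (m *\<^sub>R \<eta>h x + (h x / 2) *\<^sub>R (D *v \<eta>h x))"
      using num[OF x] by (simp add: d_def Z1_def matvec_simps algebra_simps)
    have \<eta>h: "\<eta>h x = Z2 x + \<eta> x + (h x / 2) *\<^sub>R \<eta>' x"
      by (simp add: Z2_def)
    have F: "F x = m *\<^sub>R \<eta>' x - (2 * m) *\<^sub>R cross3 (p x) (\<eta> x) + D *v \<eta> x"
      using deriv[OF x] by simp
    show "m *\<^sub>R d x + (h x / 2) *\<^sub>R (D *v d x)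
      = Z1 x + m *\<^sub>R (w x - \<eta> x) - m *\<^sub>R Z2 x
        + ((h x)\<^sup>2 * (m / 2)) *\<^sub>R cross3 (p' x) (cross3 (p' x) (w x))
        + (h x / 2) *\<^sub>R (F' x - F x) - ((h x)\<^sup>2 * (1 / 4)) *\<^sub>R (D *v \<eta>' x) - (h x / 2) *\<^sub>R (D *v Z2 x)
        + h x *\<^sub>R (m *\<^sub>R (cross3 (p' x) (w x) - cross3 (p x) (\<eta> x)))"
      unfolding num' \<eta>h F
      by (simp only: cross_simps matvec_simps vec_simps) (simp add: field_simps power2_eq_square)
  qed
  then obtain C where "0 \<le> C" and C: "\<And>x. x \<in> X \<Longrightarrow> norm (m *\<^sub>R d x + (h x / 2) *\<^sub>R (D *v d x)) \<le> C * e x"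
    by (rule dominatedE) blast
  have "BigO d e"
  proof (rule dominatedI[of "C / m"])
    fix x assume x: "x \<in> X"
    have "m * norm (d x) * norm (d x) \<le> d x \<bullet> (m *\<^sub>R d x + (h x / 2) *\<^sub>R (D *v d x))"
      using D[of "d x"] h_pos[OF x]
      by (simp add: inner_add_right dot_square_norm power2_eq_square mult.assoc)
    also have "\<dots> \<le> norm (d x) * norm (m *\<^sub>R d x + (h x / 2) *\<^sub>R (D *v d x))"
      by (rule norm_cauchy_schwarz)
    finally have "m * norm (d x) \<le> norm (m *\<^sub>R d x + (h x / 2) *\<^sub>R (D *v d x))"
      by (cases "d x = 0") (auto simp: mult.commute[of _ "norm (d x)"])
    with C[OF x] show "norm (d x) \<le> C / m * e x"
      using \<open>m > 0\<close> by (simp add: field_simps)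
  qed (use \<open>0 \<le> C\<close> \<open>m > 0\<close> in simp)
  then show ?thesis
    by (simp add: d_def[abs_def])
qed

text \<open>Here \<open>v\<close> is the argument of the closing exponential, formed from exact data
  after the rewriting m wh - (h/2) D wh = (m wh + (h/2) D wh) - h D wh, whose bracket the half-step
  equation supplies. The proof runs backwards: \<open>v\<close> is compared with the truncated
  exp(-hq) applied to the end value, and the truncated exp(hq) is then applied to both.\<close>

lemma exact_velocity:
  fixes m :: real and D :: "real^3^3" and p q \<eta> \<eta>1 \<eta>h \<eta>' \<eta>1' F F1 :: "'x \<Rightarrow> real^3"
  defines "v \<equiv> \<lambda>x. m *\<^sub>R \<eta> x + h x *\<^sub>R cross3 (p x) (m *\<^sub>R \<eta> x)
      + ((h x)\<^sup>2 * (1 / 2)) *\<^sub>R cross3 (p x) (cross3 (p x) (m *\<^sub>R \<eta> x))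
      + (h x / 2) *\<^sub>R (F x + F1 x) - h x *\<^sub>R (D *v \<eta>h x)"
  assumes deriv: "\<And>x. x \<in> X \<Longrightarrow> m *\<^sub>R \<eta>' x = (2 * m) *\<^sub>R cross3 (p x) (\<eta> x) + F x - D *v \<eta> x"
    and deriv1: "\<And>x. x \<in> X \<Longrightarrow> m *\<^sub>R \<eta>1' x = (2 * m) *\<^sub>R cross3 (q x) (\<eta>1 x) + F1 x - D *v \<eta>1 x"
    and trap: "BigO (\<lambda>x. \<eta>1 x - (\<eta> x + (h x / 2) *\<^sub>R (\<eta>' x + \<eta>1' x))) (\<lambda>x. h x ^ 3)"
    and mid: "BigO (\<lambda>x. \<eta>h x - (1 / 2) *\<^sub>R (\<eta> x + \<eta>1 x)) (\<lambda>x. (h x)\<^sup>2)"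
    and diff: "BigO (\<lambda>x. q x - p x) h" "BigO (\<lambda>x. \<eta>1 x - \<eta> x) h"
    and bnd: "BigO p (\<lambda>_. 1)" "BigO q (\<lambda>_. 1)" "BigO \<eta> (\<lambda>_. 1)" "BigO \<eta>1 (\<lambda>_. 1)"
  shows "BigO (\<lambda>x. m *\<^sub>R \<eta>1 x - (v x + h x *\<^sub>R cross3 (q x) (v x)
      + ((h x)\<^sup>2 * (1 / 2)) *\<^sub>R cross3 (q x) (cross3 (q x) (v x)))) (\<lambda>x. h x ^ 3)"
proof -
  define Z1 where "Z1 x = \<eta>1 x - (\<eta> x + (h x / 2) *\<^sub>R (\<eta>' x + \<eta>1' x))" for x
  define Z2 where "Z2 x = \<eta>h x - (1 / 2) *\<^sub>R (\<eta> x + \<eta>1 x)" for x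
  have Z: "BigO Z1 (\<lambda>x. h x ^ 3)" "BigO Z2 (\<lambda>x. (h x)\<^sup>2)"
    using trap mid by (simp_all add: Z1_def[abs_def] Z2_def[abs_def])
  define u where "u x = m *\<^sub>R \<eta>1 x" for x
  \<comment> \<open>Adjointness in use: the rotation is undone on the end value instead of being
    applied to \<open>v\<close>, so the first-order terms at p and at q enter symmetrically and
    match the trapezoidal rule.\<close>
  define V where "V x = v x - (u x - h x *\<^sub>R cross3 (q x) (u x)
      + ((h x)\<^sup>2 * (1 / 2)) *\<^sub>R cross3 (q x) (cross3 (q x) (u x)))" for x
  have u: "BigO u (\<lambda>_. 1)"
    unfolding u_def by (intro dominated_scaleR bnd)
  have cc: "BigO (\<lambda>x. cross3 (q x) (cross3 (q x) (\<eta>1 x)) - cross3 (p x) (cross3 (p x) (\<eta> x))) h"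
    by (intro dominated_bilinear_diff[OF bounded_bilinear_cross3] diff bnd O_cross)
  have V: "BigO V (\<lambda>x. h x ^ 3)"
  proof (rule dominated_cong)
    \<comment> \<open>Inserting the differential equation at both ends cancels all first-order
      rotation terms. What remains is the trapezoidal error, h times the midpoint error, and h^2
      times a difference of double cross products.\<close>
    show "BigO (\<lambda>x. - (m *\<^sub>R Z1 x) - (h x * 1) *\<^sub>R (D *v Z2 x)
        - ((h x)\<^sup>2 * (m / 2)) *\<^sub>R (cross3 (q x) (cross3 (q x) (\<eta>1 x)) - cross3 (p x) (cross3 (p x) (\<eta> x))))
        (\<lambda>x. h x ^ 3)"
      by (intro dominated_diff dominated_uminus dominated_scaleR Z O_scale_h_h2 dominated_matrix_vector
          O_scale_h2_h cc)
    fix x assume x: "x \<in> X"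
    have F: "F x = m *\<^sub>R \<eta>' x - (2 * m) *\<^sub>R cross3 (p x) (\<eta> x) + D *v \<eta> x"
      "F1 x = m *\<^sub>R \<eta>1' x - (2 * m) *\<^sub>R cross3 (q x) (\<eta>1 x) + D *v \<eta>1 x"
      using deriv[OF x] deriv1[OF x] by simp_all
    show "V x = - (m *\<^sub>R Z1 x) - (h x * 1) *\<^sub>R (D *v Z2 x)
        - ((h x)\<^sup>2 * (m / 2)) *\<^sub>R (cross3 (q x) (cross3 (q x) (\<eta>1 x)) - cross3 (p x) (cross3 (p x) (\<eta> x)))"
      unfolding V_def v_def u_def Z1_def Z2_def F
      by (simp only: cross_simps matvec_simps vec_simps) (simp add: field_simps power2_eq_square)
  qed
  show ?thesis
  proof (rule dominated_cong)
    \<comment> \<open>With Q the cross product by h q, (1 + Q + Q^2/2)(1 - Q + Q^2/2) = 1 + Q^4/4;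
      this is the origin of the fourfold cross product.\<close>
    show "BigO (\<lambda>x. - V x - h x *\<^sub>R cross3 (q x) (V x) - (h x)\<^sup>2 *\<^sub>R ((1 / 2) *\<^sub>R cross3 (q x) (cross3 (q x) (V x)))
        - ((h x)\<^sup>2 * (1 / 4)) *\<^sub>R ((h x)\<^sup>2 *\<^sub>R cross3 (q x) (cross3 (q x) (cross3 (q x) (cross3 (q x) (u x))))))
        (\<lambda>x. h x ^ 3)"
    proof (intro dominated_diff dominated_uminus V O_scale_h2_h O_h2_h)
      have c: "BigO (\<lambda>x. cross3 (q x) (cross3 (q x) (cross3 (q x) (cross3 (q x) (u x))))) (\<lambda>_. 1)"
        by (intro O_cross bnd u)
      show "BigO (\<lambda>x. (h x)\<^sup>2 *\<^sub>R cross3 (q x) (cross3 (q x) (cross3 (q x) (cross3 (q x) (u x))))) (\<lambda>x. (h x)\<^sup>2)"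
        using O_scale_h2_1[OF c, of 1] by simp
      show "BigO (\<lambda>x. h x *\<^sub>R cross3 (q x) (V x)) (\<lambda>x. h x ^ 3)"
        by (intro O_scale_le O_cross bnd V abs_h_le_1)
      show "BigO (\<lambda>x. (h x)\<^sup>2 *\<^sub>R ((1 / 2) *\<^sub>R cross3 (q x) (cross3 (q x) (V x)))) (\<lambda>x. h x ^ 3)"
        by (intro O_scale_le dominated_scaleR O_cross bnd V h2_le_1)
    qed
    fix x assume "x \<in> X"
    have v: "v x = V x + (u x - h x *\<^sub>R cross3 (q x) (u x)
      + ((h x)\<^sup>2 * (1 / 2)) *\<^sub>R cross3 (q x) (cross3 (q x) (u x)))"
      by (simp add: V_def)
    show "m *\<^sub>R \<eta>1 x - (v x + h x *\<^sub>R cross3 (q x) (v x)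
          + ((h x)\<^sup>2 * (1 / 2)) *\<^sub>R cross3 (q x) (cross3 (q x) (v x)))
        = - V x - h x *\<^sub>R cross3 (q x) (V x) - (h x)\<^sup>2 *\<^sub>R ((1 / 2) *\<^sub>R cross3 (q x) (cross3 (q x) (V x)))
        - ((h x)\<^sup>2 * (1 / 4)) *\<^sub>R ((h x)\<^sup>2 *\<^sub>R cross3 (q x) (cross3 (q x) (cross3 (q x) (cross3 (q x) (u x)))))"
      unfolding v u_def[symmetric]
      by (simp only: cross_simps vec_simps) (simp add: field_simps power2_eq_square)
  qed
qed

text \<open>The vector \<open>v\<close> is the one of \<open>exact_velocity\<close>, and
  \<open>?v'\<close> is its numerical counterpart. The half-step equation must eliminate m wh,
  because wh is known only to O(e) while the increment of the error has to be O(h e). Since q' - q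
  contains the unknown end velocity, the lemma is applied with the larger gauge.\<close>

lemma velocity_step:
  fixes m :: real and D :: "real^3^3" and p q p' q' \<eta> \<eta>1 \<eta>h w w1 wh F F1 F' F1' :: "'x \<Rightarrow> real^3"
  defines "v \<equiv> \<lambda>x. m *\<^sub>R \<eta> x + h x *\<^sub>R cross3 (p x) (m *\<^sub>R \<eta> x)
      + ((h x)\<^sup>2 * (1 / 2)) *\<^sub>R cross3 (p x) (cross3 (p x) (m *\<^sub>R \<eta> x))
      + (h x / 2) *\<^sub>R (F x + F1 x) - h x *\<^sub>R (D *v \<eta>h x)"
  assumes "m > 0"
    and half: "\<And>x. x \<in> X \<Longrightarrow> m *\<^sub>R wh x + (h x / 2) *\<^sub>R (D *v wh x)
      = mat_exp (h x *\<^sub>R skew (p' x)) *v (m *\<^sub>R w x) + (h x / 2) *\<^sub>R F' x"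
    and num: "\<And>x. x \<in> X \<Longrightarrow> m *\<^sub>R w1 x = mat_exp (h x *\<^sub>R skew (q' x)) *v
        (m *\<^sub>R wh x - (h x / 2) *\<^sub>R (D *v wh x) + (h x / 2) *\<^sub>R F1' x)"
    and exact: "BigO (\<lambda>x. m *\<^sub>R \<eta>1 x - (v x + h x *\<^sub>R cross3 (q x) (v x)
      + ((h x)\<^sup>2 * (1 / 2)) *\<^sub>R cross3 (q x) (cross3 (q x) (v x)))) (\<lambda>x. h x ^ 3)"
    and err: "BigO (\<lambda>x. w x - \<eta> x) e" "BigO (\<lambda>x. p' x - p x) e" "BigO (\<lambda>x. q' x - q x) e"
      "BigO (\<lambda>x. F' x - F x) e" "BigO (\<lambda>x. F1' x - F1 x) e" "BigO (\<lambda>x. wh x - \<eta>h x) e"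
    and bnd: "BigO w (\<lambda>_. 1)" "BigO \<eta> (\<lambda>_. 1)" "BigO \<eta>h (\<lambda>_. 1)" "BigO p (\<lambda>_. 1)" "BigO p' (\<lambda>_. 1)"
      "BigO q (\<lambda>_. 1)" "BigO q' (\<lambda>_. 1)" "BigO F (\<lambda>_. 1)" "BigO F1 (\<lambda>_. 1)"
  shows "BigO (\<lambda>x. (w1 x - \<eta>1 x) - (w x - \<eta> x)) (\<lambda>x. h x * e x)"
proof -
  let ?v' = "\<lambda>x. m *\<^sub>R wh x - (h x / 2) *\<^sub>R (D *v wh x) + (h x / 2) *\<^sub>R F1' x"
  define Z1 where "Z1 x = mat_exp (h x *\<^sub>R skew (p' x)) *v (m *\<^sub>R w x)
      - (m *\<^sub>R w x + h x *\<^sub>R cross3 (p' x) (m *\<^sub>R w x)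
        + ((h x)\<^sup>2 * (1 / 2)) *\<^sub>R cross3 (p' x) (cross3 (p' x) (m *\<^sub>R w x)))" for x
  have h1: "\<bar>h x\<bar> \<le> 1" "\<bar>h x / 2\<bar> \<le> 1" if "x \<in> X" for x
    using h_pos[OF that] h_le[OF that] by auto
  have Z1: "BigO Z1 (\<lambda>x. h x * e x)"
    unfolding Z1_def by (intro O_h3_he O_mat_exp_skew_vector bnd dominated_scaleR)
  have pw: "BigO (\<lambda>x. cross3 (p' x) (w x) - cross3 (p x) (\<eta> x)) e"
    by (intro dominated_bilinear_diff[OF bounded_bilinear_cross3] err bnd)
  have ppw: "BigO (\<lambda>x. cross3 (p' x) (cross3 (p' x) (w x)) - cross3 (p x) (cross3 (p x) (\<eta> x))) e"
    by (intro dominated_bilinear_diff[OF bounded_bilinear_cross3] err bnd O_cross)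
  have A: "BigO (\<lambda>x. ?v' x - v x - m *\<^sub>R (w x - \<eta> x)) (\<lambda>x. h x * e x)"
  proof (rule dominated_cong)
    show "BigO (\<lambda>x. Z1 x + (h x * m) *\<^sub>R (cross3 (p' x) (w x) - cross3 (p x) (\<eta> x))
        + (h x * (m / 2)) *\<^sub>R (h x *\<^sub>R (cross3 (p' x) (cross3 (p' x) (w x)) - cross3 (p x) (cross3 (p x) (\<eta> x))))
        + (h x * (1 / 2)) *\<^sub>R ((F' x - F x) + (F1' x - F1 x)) - (h x * 1) *\<^sub>R (D *v (wh x - \<eta>h x)))
        (\<lambda>x. h x * e x)"
      by (intro dominated_add dominated_diff Z1 O_scale_h pw O_scale_le ppw h1 err dominated_matrix_vector)
    fix x assume x: "x \<in> X"
    have "m *\<^sub>R wh x = Z1 x + (m *\<^sub>R w x + h x *\<^sub>R cross3 (p' x) (m *\<^sub>R w x)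
        + ((h x)\<^sup>2 * (1 / 2)) *\<^sub>R cross3 (p' x) (cross3 (p' x) (m *\<^sub>R w x)))
        + (h x / 2) *\<^sub>R F' x - (h x / 2) *\<^sub>R (D *v wh x)"
      using half[OF x] by (simp add: Z1_def algebra_simps)
    then show "?v' x - v x - m *\<^sub>R (w x - \<eta> x)
      = Z1 x + (h x * m) *\<^sub>R (cross3 (p' x) (w x) - cross3 (p x) (\<eta> x))
        + (h x * (m / 2)) *\<^sub>R (h x *\<^sub>R (cross3 (p' x) (cross3 (p' x) (w x)) - cross3 (p x) (cross3 (p x) (\<eta> x))))
        + (h x * (1 / 2)) *\<^sub>R ((F' x - F x) + (F1' x - F1 x)) - (h x * 1) *\<^sub>R (D *v (wh x - \<eta>h x))"
      unfolding v_def
      by (simp only: cross_simps matvec_simps vec_simps) (simp add: field_simps power2_eq_square)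
  qed
  have v: "BigO v (\<lambda>_. 1)"
    unfolding v_def
    by (intro dominated_add dominated_diff dominated_scaleR bnd O_scale_le O_cross h1
        dominated_matrix_vector O_h_1[OF O_h2_h[OF O_scale_h2_1]])
  have he: "BigO f e" if "BigO f (\<lambda>x. h x * e x)" for f :: "'x \<Rightarrow> real^3"
    using that h_pos h_le h2_le_e
    by (elim O_le) (auto intro!: mult_left_le_one_le intro: order_trans[OF zero_le_power2] less_imp_le)
  have vv: "BigO (\<lambda>x. ?v' x - v x) e"
  proof (rule dominated_cong)
    show "BigO (\<lambda>x. (?v' x - v x - m *\<^sub>R (w x - \<eta> x)) + m *\<^sub>R (w x - \<eta> x)) e"
      by (intro dominated_add he A dominated_scaleR err)
  qed simp
  have v': "BigO ?v' (\<lambda>_. 1)"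
    by (rule dominated_cong[OF dominated_add[OF O_e_1[OF vv] v]]) simp
  have qv: "BigO (\<lambda>x. cross3 (q' x) (?v' x) - cross3 (q x) (v x)) e"
    by (intro dominated_bilinear_diff[OF bounded_bilinear_cross3] err bnd vv v)
  have qqv: "BigO (\<lambda>x. cross3 (q' x) (cross3 (q' x) (?v' x)) - cross3 (q x) (cross3 (q x) (v x))) e"
    by (intro dominated_bilinear_diff[OF bounded_bilinear_cross3] err bnd O_cross vv v)
  let ?B = "\<lambda>x. mat_exp (h x *\<^sub>R skew (q' x)) *v ?v' x
      - (?v' x + h x *\<^sub>R cross3 (q' x) (?v' x)
        + ((h x)\<^sup>2 * (1 / 2)) *\<^sub>R cross3 (q' x) (cross3 (q' x) (?v' x)))"
  let ?E = "\<lambda>x. m *\<^sub>R \<eta>1 x - (v x + h x *\<^sub>R cross3 (q x) (v x)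
      + ((h x)\<^sup>2 * (1 / 2)) *\<^sub>R cross3 (q x) (cross3 (q x) (v x)))"
  have B: "BigO ?B (\<lambda>x. h x * e x)"
    by (intro O_h3_he O_mat_exp_skew_vector bnd v')
  have E: "BigO ?E (\<lambda>x. h x * e x)"
    by (intro O_h3_he exact)
  have "BigO (\<lambda>x. m *\<^sub>R ((w1 x - \<eta>1 x) - (w x - \<eta> x))) (\<lambda>x. h x * e x)"
  proof (rule dominated_cong)
    show "BigO (\<lambda>x. ?B x - ?E x + (?v' x - v x - m *\<^sub>R (w x - \<eta> x))
        + (h x * 1) *\<^sub>R (cross3 (q' x) (?v' x) - cross3 (q x) (v x))
        + (h x * (1 / 2)) *\<^sub>R (h x *\<^sub>R (cross3 (q' x) (cross3 (q' x) (?v' x)) - cross3 (q x) (cross3 (q x) (v x)))))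
        (\<lambda>x. h x * e x)"
      by (intro dominated_add dominated_diff B E A O_scale_h qv O_scale_le h1 qqv)
    fix x assume x: "x \<in> X"
    show "m *\<^sub>R ((w1 x - \<eta>1 x) - (w x - \<eta> x))
      = ?B x - ?E x + (?v' x - v x - m *\<^sub>R (w x - \<eta> x))
        + (h x * 1) *\<^sub>R (cross3 (q' x) (?v' x) - cross3 (q x) (v x))
        + (h x * (1 / 2)) *\<^sub>R (h x *\<^sub>R (cross3 (q' x) (cross3 (q' x) (?v' x)) - cross3 (q x) (cross3 (q x) (v x))))"
      unfolding num[OF x, symmetric] by (simp add: algebra_simps power2_eq_square)
  qed
  then show ?thesis
    using \<open>m > 0\<close> by (auto dest: dominated_scaleR[where c = "1 / m"])
qed

end

section \<open>Solvability of the step equations\<close>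

text \<open>The kernel of the shifted matrix is trivial because its quadratic form is at least m
  |v|^2; this makes \<open>matrix_inv\<close> an actual inverse.\<close>

lemma matrix_inv_shift_mult:
  fixes D :: "real^'n^'n" and z :: "real^'n"
  assumes "m > 0" "0 \<le> c" and D: "\<And>v. 0 \<le> v \<bullet> (D *v v)"
  defines "x \<equiv> matrix_inv (m *\<^sub>R mat 1 + c *\<^sub>R D) *v z"
  shows "m *\<^sub>R x + c *\<^sub>R (D *v x) = z"
proof -
  let ?M = "m *\<^sub>R mat 1 + c *\<^sub>R D"
  have M: "?M *v v = m *\<^sub>R v + c *\<^sub>R (D *v v)" for v
    by (simp add: matrix_vector_mult_add_rdistrib scaleR_matrix_vector_assoc[symmetric])
  have "v = 0" if "?M *v v = 0" for v
  proof -
    have "0 = v \<bullet> (?M *v v)"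
      using that by simp
    also have "\<dots> = m * (v \<bullet> v) + c * (v \<bullet> (D *v v))"
      by (simp add: M inner_add_right)
    finally have "m * (v \<bullet> v) \<le> 0"
      using mult_nonneg_nonneg[OF \<open>0 \<le> c\<close> D[of v]] by linarith
    then show ?thesis
      using \<open>m > 0\<close> inner_gt_zero_iff[of v] by (metis mult_pos_pos not_le)
  qed
  then have "invertible ?M"
    by (simp add: invertible_left_inverse matrix_left_invertible_ker)
  then have "?M ** matrix_inv ?M = mat 1"
    unfolding invertible_def matrix_inv_def by (rule someI2_ex) simp
  then have "?M *v x = z"
    by (simp add: x_def matrix_vector_mul_assoc)
  then show ?thesis
    by (simp add: M)
qed

lemma continuous_on_mat_exp: "continuous_on S (mat_exp :: real^'n^'n \<Rightarrow> _)"
proof (rule continuous_on_subset[OF _ subset_UNIV], rule continuous_at_imp_continuous_on, rule ballI)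
  fix A :: "real^'n^'n"
  let ?M = "norm A + 1"
  let ?C = "norm (mat 1 :: real^'n^'n) * exp (1 + ?M)"
  have "continuous_on (ball A 1) mat_exp"
  proof (rule lipschitz_on_continuous_on)
    show "?C-lipschitz_on (ball A 1) mat_exp"
    proof (rule lipschitz_onI)
      fix X Y assume "X \<in> ball A 1" "Y \<in> ball A 1"
      then have "norm X \<le> ?M" "norm Y \<le> ?M"
        using norm_triangle_sub[of X A] norm_triangle_sub[of Y A]
        by (auto simp: dist_norm norm_minus_commute)
      then show "dist (mat_exp X) (mat_exp Y) \<le> ?C * dist X Y"
        unfolding dist_norm by (rule mat_exp_diff_le)
    qed simp
  qed
  then show "isCont mat_exp A"
    by (simp add: continuous_on_eq_continuous_at)
qed

text \<open>The right-hand side has norm \<open>norm v\<close> for every \<open>w\<close>, so Brouwer's theorem applies to a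
  ball for every step size.\<close>

lemma implicit_rotation_solvable:
  fixes b :: "real^3"
  assumes "m > 0"
  shows "\<exists>w. m *\<^sub>R w = mat_exp (c *\<^sub>R skew (b - w)) *v v"
proof -
  define f where "f w = (1 / m) *\<^sub>R (mat_exp (c *\<^sub>R skew (b - w)) *v v)" for w
  have f_le: "norm (f w) \<le> norm v / m" for w
  proof -
    have "c *\<^sub>R skew (b - w) = skew (c *\<^sub>R (b - w))"
      using linear_scale[OF bounded_linear.linear[OF bounded_linear_skew]] by metis
    then show ?thesis
      using \<open>m > 0\<close> by (simp only: f_def norm_scaleR mat_exp_skew_norm) simp
  qed
  \<comment> \<open>The additional 1 keeps the radius positive when v = 0.\<close>
  have "continuous_on (cball 0 (norm v / m + 1)) f"
  proof -
    have "continuous_on UNIV (\<lambda>w. c *\<^sub>R skew (b - w))"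
      by (intro continuous_intros bounded_linear.continuous_on[OF bounded_linear_skew])
    from continuous_on_compose2[OF continuous_on_mat_exp this subset_UNIV]
    have "continuous_on UNIV (\<lambda>w. mat_exp (c *\<^sub>R skew (b - w)))" .
    then have "continuous_on UNIV f"
      unfolding f_def
      by (intro continuous_intros bounded_linear.continuous_on[OF
            bounded_bilinear.bounded_linear_left[OF bounded_bilinear_matrix_vector_mult]])
    then show ?thesis
      by (rule continuous_on_subset) simp
  qed
  moreover have "f \<in> cball 0 (norm v / m + 1) \<rightarrow> cball 0 (norm v / m + 1)"
    using f_le by (auto simp: add_increasing2)
  moreover have "0 < norm v / m + 1"
    using \<open>m > 0\<close> by (simp add: add_nonneg_pos)
  ultimately obtain w where "f w = w"
    using brouwer_ball by blast
  then have "m *\<^sub>R w = m *\<^sub>R f w"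
    by simp
  also have "\<dots> = mat_exp (c *\<^sub>R skew (b - w)) *v v"
    using \<open>m > 0\<close> by (simp add: f_def)
  finally show ?thesis ..
qed

text \<open>Only the velocity equation is implicit: the half-step value and the new attitude are
  explicit, so the vector being rotated is fixed before \<open>w1\<close> is sought.\<close>

lemma filter_step_solvable:
  assumes "m > 0"
  shows "\<exists>z'. filter_step m D \<phi> E W U \<Omega> t h z z'"
proof -
  obtain R w where z: "z = (R, w)"
    by fastforce
  let ?wh = "half_step m D \<phi> E W U \<Omega> t h (R, w)"
  let ?R1 = "R ** mat_exp (h *\<^sub>R skew ((1 / 2) *\<^sub>R (\<Omega> t + \<Omega> (t + h)) - ?wh))"
  obtain w1 where "m *\<^sub>R w1 = mat_exp (- (h / 2) *\<^sub>R skew (\<Omega> (t + h) - w1)) *v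
          ((m *\<^sub>R mat 1 - (h / 2) *\<^sub>R D) *v ?wh + (h / 2) *\<^sub>R feedback \<phi> E W U (t + h) ?R1)"
    using implicit_rotation_solvable[OF assms] by blast
  then have "filter_step m D \<phi> E W U \<Omega> t h z (?R1, w1)"
    by (simp add: filter_step_def z Let_def)
  then show ?thesis ..
qed

lemma discrete_solution_exists:
  assumes "\<And>t z. \<exists>z'. step t h z z'"
  shows "\<exists>ys. discrete_solution step t\<^sub>0 h N y\<^sub>0 ys"
proof -
  define ys where "ys = rec_nat y\<^sub>0 (\<lambda>i z. SOME z'. step (t\<^sub>0 + real i * h) h z z')"
  have "step (t\<^sub>0 + real i * h) h (ys i) (ys (Suc i))" for i
    using someI_ex[OF assms] by (simp add: ys_def)
  then have "discrete_solution step t\<^sub>0 h N y\<^sub>0 ys"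
    by (simp add: discrete_solution_def) (simp add: ys_def)
  then show ?thesis
    by blast
qed

section \<open>Accumulation of the one-step errors\<close>

text \<open>A discrete Gronwall argument with a bootstrap: the one-step estimate is available only
  while the error is at most 1, and \<open>small\<close> keeps the bound being proved below 1 along
  the whole grid.\<close>

lemma discrete_solution_error:
  fixes err :: "real \<Rightarrow> 's \<Rightarrow> real"
  assumes step: "\<And>t z z'. t\<^sub>0 \<le> t \<Longrightarrow> t + h \<le> T \<Longrightarrow> err t z \<le> 1 \<Longrightarrow> step t h z z' \<Longrightarrow>
      err (t + h) z' \<le> (1 + C * h) * err t z + C * h ^ 3"
    and ys: "discrete_solution step t\<^sub>0 h N y\<^sub>0 ys" and "err t\<^sub>0 y\<^sub>0 = 0"
    and "0 \<le> C" "0 < h" and N: "real N * h = T - t\<^sub>0"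
    and small: "exp (C * (T - t\<^sub>0)) * (T - t\<^sub>0) * C * h\<^sup>2 \<le> 1"
  shows "i \<le> N \<Longrightarrow> err (t\<^sub>0 + real i * h) (ys i) \<le> exp (C * (T - t\<^sub>0)) * (T - t\<^sub>0) * C * h\<^sup>2"
proof -
  have le: "(1 + C * h) ^ i * real i * (C * h ^ 3) \<le> exp (C * (T - t\<^sub>0)) * (T - t\<^sub>0) * C * h\<^sup>2"
    if "i \<le> N" for i
  proof -
    have ih: "real i * h \<le> T - t\<^sub>0"
      using that \<open>0 < h\<close> unfolding N[symmetric] by simp
    have "(1 + C * h) ^ i \<le> exp (C * h) ^ i"
      using \<open>0 \<le> C\<close> \<open>0 < h\<close> by (intro power_mono) (simp_all add: exp_ge_add_one_self)
    also have "\<dots> = exp (C * (real i * h))"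
      by (simp add: exp_of_nat_mult[symmetric] mult_ac)
    also have "\<dots> \<le> exp (C * (T - t\<^sub>0))"
      using ih \<open>0 \<le> C\<close> by (simp add: mult_left_mono)
    finally have "(1 + C * h) ^ i * (real i * h) \<le> exp (C * (T - t\<^sub>0)) * (T - t\<^sub>0)"
      using ih \<open>0 < h\<close> by (intro mult_mono) auto
    then have "(1 + C * h) ^ i * (real i * h) * (C * h\<^sup>2) \<le> exp (C * (T - t\<^sub>0)) * (T - t\<^sub>0) * (C * h\<^sup>2)"
      using \<open>0 \<le> C\<close> by (intro mult_right_mono) auto
    then show ?thesis
      by (simp add: power2_eq_square power3_eq_cube mult_ac)
  qed
  \<comment> \<open>The invariant counts i local errors, each amplified by at most (1 + C h)^i; the
    exponential bound is derived from it afterwards.\<close>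
  have main: "err (t\<^sub>0 + real i * h) (ys i) \<le> (1 + C * h) ^ i * real i * (C * h ^ 3)" if "i \<le> N" for i
    using that
  proof (induction i)
    case 0
    then show ?case
      using ys assms(3) by (simp add: discrete_solution_def)
  next
    case (Suc i)
    let ?t = "t\<^sub>0 + real i * h" and ?a = "1 + C * h"
    have IH: "err ?t (ys i) \<le> ?a ^ i * real i * (C * h ^ 3)"
      using Suc by simp
    have a: "1 \<le> ?a"
      using \<open>0 \<le> C\<close> \<open>0 < h\<close> by simp
    have "real (Suc i) * h \<le> T - t\<^sub>0"
      using Suc.prems \<open>0 < h\<close> unfolding N[symmetric] by (intro mult_right_mono) auto
    then have "?t + h \<le> T"
      by (simp add: algebra_simps)
    moreover have "err ?t (ys i) \<le> 1"
      using IH le[of i] small Suc.prems by linarith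
    moreover have "step ?t h (ys i) (ys (Suc i))"
      using ys Suc.prems by (simp add: discrete_solution_def)
    ultimately have "err (?t + h) (ys (Suc i)) \<le> ?a * err ?t (ys i) + C * h ^ 3"
      using \<open>0 < h\<close> by (intro step) auto
    \<comment> \<open>The new local error is enlarged by \<open>?a ^ Suc i\<close>, which is at
      least 1, to fit the shape of the invariant.\<close>
    also have "\<dots> \<le> ?a * (?a ^ i * real i * (C * h ^ 3)) + ?a ^ Suc i * (C * h ^ 3)"
    proof (intro add_mono mult_left_mono IH)
      have "1 * (C * h ^ 3) \<le> ?a ^ Suc i * (C * h ^ 3)"
        using \<open>0 \<le> C\<close> \<open>0 < h\<close> one_le_power[OF a, of "Suc i"] by (intro mult_right_mono) auto
      then show "C * h ^ 3 \<le> ?a ^ Suc i * (C * h ^ 3)"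
        by simp
    qed (use a in simp)
    also have "\<dots> = ?a ^ Suc i * real (Suc i) * (C * h ^ 3)"
      by (simp add: distrib_left distrib_right mult.assoc)
    also have "?t + h = t\<^sub>0 + real (Suc i) * h"
      by (simp add: algebra_simps)
    finally show ?case .
  qed
  show "i \<le> N \<Longrightarrow> err (t\<^sub>0 + real i * h) (ys i) \<le> exp (C * (T - t\<^sub>0)) * (T - t\<^sub>0) * C * h\<^sup>2"
    using main[of i] le[of i] by linarith
qed

section \<open>Error along an exact solution\<close>

lemma Cn_on_bounded_linear:
  assumes "bounded_linear L"
  shows "Cn_on n f S \<Longrightarrow> Cn_on n (\<lambda>x. L (f x)) S"
proof (induction n arbitrary: f)
  case 0
  then show ?case
    by (simp add: bounded_linear.continuous_on[OF assms])
next
  case (Suc n)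
  then obtain f' where "\<forall>x\<in>S. (f has_vector_derivative f' x) (at x within S)" "Cn_on n f' S"
    by auto
  then show ?case
    using Suc.IH[of f'] bounded_linear.has_vector_derivative[OF assms]
    by (auto intro!: exI[of _ "\<lambda>x. L (f' x)"])
qed

text \<open>The feedback bound is uniform in time but local in the attitude, since the potential
  grows quadratically in it. The radius is chosen later, from bounds on the attitudes being
  compared.\<close>

locale exact_filter_solution =
  fixes m t\<^sub>0 T :: real and D :: "real^3^3" and \<phi> :: "real \<Rightarrow> real"
    and E U :: "real \<Rightarrow> real^'n^3" and W :: "real \<Rightarrow> real^'n^'n" and \<Omega> :: "real \<Rightarrow> real^3"
    and R :: "real \<Rightarrow> real^3^3" and \<omega> \<omega>' :: "real \<Rightarrow> real^3"
  assumes t\<^sub>0_less: "t\<^sub>0 < T" and m_pos: "m > 0" and D_nonneg: "\<And>v. 0 \<le> v \<bullet> (D *v v)"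
    and feedback_lipschitz: "\<And>B. 0 \<le> B \<Longrightarrow> \<exists>C\<ge>0. \<forall>t\<in>{t\<^sub>0..T}. \<forall>P Q. norm P \<le> B \<longrightarrow> norm Q \<le> B \<longrightarrow>
        norm (feedback \<phi> E W U t P) \<le> C \<and>
        norm (feedback \<phi> E W U t P - feedback \<phi> E W U t Q) \<le> C * norm (P - Q)"
    and C3_R: "Cn_on 3 R {t\<^sub>0..T}" and C3_\<omega>: "Cn_on 3 \<omega> {t\<^sub>0..T}"
    and rotation_R: "\<And>t. t \<in> {t\<^sub>0..T} \<Longrightarrow> rotation_matrix (R t)"
    and deriv_R: "\<And>t. t \<in> {t\<^sub>0..T} \<Longrightarrow>
        (R has_vector_derivative R t ** skew (\<Omega> t - \<omega> t)) (at t within {t\<^sub>0..T})"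
    and deriv_\<omega>: "\<And>t. t \<in> {t\<^sub>0..T} \<Longrightarrow> (\<omega> has_vector_derivative \<omega>' t) (at t within {t\<^sub>0..T})"
    and ode: "\<And>t. t \<in> {t\<^sub>0..T} \<Longrightarrow> m *\<^sub>R \<omega>' t =
        - (m *\<^sub>R cross3 (\<Omega> t - \<omega> t) (\<omega> t)) + feedback \<phi> E W U t (R t) - D *v \<omega> t"
begin

abbreviation step where "step \<equiv> filter_step m D \<phi> E W U \<Omega>"
abbreviation half where "half \<equiv> half_step m D \<phi> E W U \<Omega>"
abbreviation F where "F \<equiv> feedback \<phi> E W U"

definition err :: "real \<Rightarrow> (real^3^3) \<times> (real^3) \<Rightarrow> real" where
  "err t z = norm (fst z - R t) + norm (snd z - \<omega> t)"

text \<open>The index set of the domination statements: every numerical step that starts close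
  enough to the exact solution, whatever its history. The bound 1 on the initial error makes the
  starting data bounded before any error estimate.\<close>

definition steps :: "(real \<times> real \<times> ((real^3^3) \<times> (real^3)) \<times> ((real^3^3) \<times> (real^3))) set" where
  "steps = {(t, h, z, z'). t\<^sub>0 \<le> t \<and> 0 < h \<and> h \<le> 1 \<and> t + h \<le> T \<and> err t z \<le> 1 \<and> step t h z z'}"

lemma dominated_feedback:
  assumes \<tau>: "\<And>x. x \<in> X \<Longrightarrow> \<tau> x \<in> {t\<^sub>0..T}" and P: "dominated X P (\<lambda>_. 1)"
  shows "dominated X (\<lambda>x. F (\<tau> x) (P x)) (\<lambda>_. 1)"
    and "dominated X Q (\<lambda>_. 1) \<Longrightarrow> dominated X (\<lambda>x. P x - Q x) g \<Longrightarrow>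
      dominated X (\<lambda>x. F (\<tau> x) (P x) - F (\<tau> x) (Q x)) g"
proof -
  obtain B where "0 \<le> B" and B: "\<And>x. x \<in> X \<Longrightarrow> norm (P x) \<le> B * 1"
    using P by (rule dominatedE) blast
  from feedback_lipschitz[OF \<open>0 \<le> B\<close>] obtain C where "0 \<le> C" and
    C: "\<forall>t\<in>{t\<^sub>0..T}. \<forall>P Q. norm P \<le> B \<longrightarrow> norm Q \<le> B \<longrightarrow> norm (F t P) \<le> C \<and> norm (F t P - F t Q) \<le> C * norm (P - Q)"
    by blast
  show "dominated X (\<lambda>x. F (\<tau> x) (P x)) (\<lambda>_. 1)"
  proof (rule dominatedI[OF \<open>0 \<le> C\<close>])
    show "norm (F (\<tau> x) (P x)) \<le> C * 1" if "x \<in> X" for x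
      using C \<tau>[OF that] B[OF that] by simp
  qed
next
  assume Q: "dominated X Q (\<lambda>_. 1)" and PQ: "dominated X (\<lambda>x. P x - Q x) g"
  obtain B1 where B1: "0 \<le> B1" "\<And>x. x \<in> X \<Longrightarrow> norm (P x) \<le> B1 * 1"
    using P by (rule dominatedE) blast
  obtain B2 where B2: "0 \<le> B2" "\<And>x. x \<in> X \<Longrightarrow> norm (Q x) \<le> B2 * 1"
    using Q by (rule dominatedE) blast
  have B: "norm (P x) \<le> max B1 B2" "norm (Q x) \<le> max B1 B2" if "x \<in> X" for x
    using B1(2)[OF that] B2(2)[OF that] by auto
  have "0 \<le> max B1 B2"
    using B1(1) by simp
  from feedback_lipschitz[OF this] obtain C where "0 \<le> C" and
    C: "\<forall>t\<in>{t\<^sub>0..T}. \<forall>P Q. norm P \<le> max B1 B2 \<longrightarrow> norm Q \<le> max B1 B2 \<longrightarrow>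
        norm (F t P) \<le> C \<and> norm (F t P - F t Q) \<le> C * norm (P - Q)"
    by blast
  obtain K where "0 \<le> K" and K: "\<And>x. x \<in> X \<Longrightarrow> norm (P x - Q x) \<le> K * g x"
    using PQ by (rule dominatedE) blast
  show "dominated X (\<lambda>x. F (\<tau> x) (P x) - F (\<tau> x) (Q x)) g"
  proof (rule dominatedI[of "C * K"])
    fix x assume x: "x \<in> X"
    have "norm (F (\<tau> x) (P x) - F (\<tau> x) (Q x)) \<le> C * norm (P x - Q x)"
      using C \<tau>[OF x] B[OF x] by blast
    also have "\<dots> \<le> C * (K * g x)"
      using K[OF x] \<open>0 \<le> C\<close> by (intro mult_left_mono)
    finally show "norm (F (\<tau> x) (P x) - F (\<tau> x) (Q x)) \<le> C * K * g x"
      by (simp add: mult.assoc)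
  qed (use \<open>0 \<le> C\<close> \<open>0 \<le> K\<close> in simp)
qed

text \<open>Both factors of R^T R' are bounded by K and have Lipschitz constant K, so the product
  rule gives 2 K^2. This Lipschitz bound is what allows the estimates at the two ends to be
  exchanged in second-order terms.\<close>

lemma estimate_bounds:
  obtains K where "0 \<le> K" "\<And>t. t \<in> {t\<^sub>0..T} \<Longrightarrow> norm (\<Omega> t - \<omega> t) \<le> K"
    "\<And>s t. s \<in> {t\<^sub>0..T} \<Longrightarrow> t \<in> {t\<^sub>0..T} \<Longrightarrow> norm ((\<Omega> s - \<omega> s) - (\<Omega> t - \<omega> t)) \<le> K * \<bar>s - t\<bar>"
proof -
  let ?s = "\<lambda>t. \<Omega> t - \<omega> t"
  let ?R' = "\<lambda>t. R t ** skew (?s t)"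
  obtain K where "0 \<le> K" and K: "\<And>t. t \<in> {t\<^sub>0..T} \<Longrightarrow> norm (R t) \<le> K"
    "\<And>t. t \<in> {t\<^sub>0..T} \<Longrightarrow> norm (?R' t) \<le> K"
    "\<And>s t. s \<in> {t\<^sub>0..T} \<Longrightarrow> t \<in> {t\<^sub>0..T} \<Longrightarrow> norm (R s - R t) \<le> K * \<bar>s - t\<bar>"
    "\<And>s t. s \<in> {t\<^sub>0..T} \<Longrightarrow> t \<in> {t\<^sub>0..T} \<Longrightarrow> norm (?R' s - ?R' t) \<le> K * \<bar>s - t\<bar>"
    by (rule C3_bounds[OF t\<^sub>0_less C3_R deriv_R]) blast+
  have skew: "skew (?s t) = transpose (R t) ** ?R' t" if "t \<in> {t\<^sub>0..T}" for t
    using rotation_R[OF that]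
    by (simp add: rotation_matrix_def orthogonal_matrix_def matrix_mul_assoc)
  show thesis
  proof (rule that[of "2 * K * K"])
    fix s assume s: "s \<in> {t\<^sub>0..T}"
    have "norm (?s s) \<le> norm (transpose (R s) ** ?R' s)"
      using norm_le_norm_skew[of "?s s"] skew[OF s] by simp
    also have "\<dots> \<le> norm (R s) * norm (?R' s)"
      using norm_matrix_mult_le[of "transpose (R s)"] by (simp add: norm_transpose)
    also have "\<dots> \<le> K * K"
      using K(1,2)[OF s] \<open>0 \<le> K\<close> by (intro mult_mono) auto
    finally show "norm (?s s) \<le> 2 * K * K"
      using \<open>0 \<le> K\<close> by (simp add: add_increasing2 order_trans)
    fix t assume t: "t \<in> {t\<^sub>0..T}"
    have "skew (?s s - ?s t) = skew (?s s) - skew (?s t)"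
      by (rule linear_diff[OF bounded_linear.linear[OF bounded_linear_skew]])
    also have "\<dots> = transpose (R s) ** ?R' s - transpose (R t) ** ?R' t"
      by (rule arg_cong2[where f = "(-)", OF skew[OF s] skew[OF t]])
    also have "\<dots> = (transpose (R s) - transpose (R t)) ** ?R' s + transpose (R t) ** (?R' s - ?R' t)"
      by (simp only: bounded_bilinear.diff_left[OF bounded_bilinear_matrix_mult]
          bounded_bilinear.diff_right[OF bounded_bilinear_matrix_mult]) simp
    also have "transpose (R s) - transpose (R t) = transpose (R s - R t)"
      by (simp add: vec_eq_iff transpose_def)
    finally have "norm (?s s - ?s t) \<le> norm (transpose (R s - R t) ** ?R' s + transpose (R t) ** (?R' s - ?R' t))"
      using norm_le_norm_skew[of "?s s - ?s t"] by simp
    also have "\<dots> \<le> norm (R s - R t) * norm (?R' s) + norm (R t) * norm (?R' s - ?R' t)"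
      using norm_matrix_mult_le[of "transpose (R s - R t)" "?R' s"]
        norm_matrix_mult_le[of "transpose (R t)" "?R' s - ?R' t"]
      unfolding norm_transpose by (rule norm_triangle_mono)
    also have "\<dots> \<le> (K * \<bar>s - t\<bar>) * K + K * (K * \<bar>s - t\<bar>)"
      using K s t \<open>0 \<le> K\<close> by (intro add_mono mult_mono) auto
    finally show "norm (?s s - ?s t) \<le> 2 * K * K * \<bar>s - t\<bar>"
      by (simp add: algebra_simps)
  qed (use \<open>0 \<le> K\<close> in simp)
qed

text \<open>The estimates follow the data flow: the half-step error depends on the start alone, the
  attitude on the half step, the feedback at the end on the new attitude, and the end velocity on
  all of them. The error after the step stays on the right because of the implicit equation.\<close>

lemma step_error:
  obtains C where "0 \<le> C"
    "\<And>t h z z'. (t, h, z, z') \<in> steps \<Longrightarrow>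
       err (t + h) z' \<le> err t z + C * h * (err t z + h\<^sup>2 + err (t + h) z')"
    "\<And>t h z z'. (t, h, z, z') \<in> steps \<Longrightarrow>
       norm (half t h z - \<omega> (t + h / 2)) \<le> C * (err t z + h\<^sup>2)"
proof -
  define \<tau> where "\<tau> x = fst x" for x :: "real \<times> real \<times> ((real^3^3) \<times> (real^3)) \<times> ((real^3^3) \<times> (real^3))"
  define h where "h x = fst (snd x)" for x :: "real \<times> real \<times> ((real^3^3) \<times> (real^3)) \<times> ((real^3^3) \<times> (real^3))"
  define z where "z x = fst (snd (snd x))" for x :: "real \<times> real \<times> ((real^3^3) \<times> (real^3)) \<times> ((real^3^3) \<times> (real^3))"
  define z' where "z' x = snd (snd (snd x))" for x :: "real \<times> real \<times> ((real^3^3) \<times> (real^3)) \<times> ((real^3^3) \<times> (real^3))"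
  have X: "t\<^sub>0 \<le> \<tau> x" "0 < h x" "h x \<le> 1" "\<tau> x + h x \<le> T" "err (\<tau> x) (z x) \<le> 1" "step (\<tau> x) (h x) (z x) (z' x)"
    if "x \<in> steps" for x
    using that by (auto simp: steps_def \<tau>_def h_def z_def z'_def)
  let ?s = "\<lambda>t. \<Omega> t - \<omega> t"
  define e where "e x = err (\<tau> x) (z x) + (h x)\<^sup>2" for x
  have err_nonneg: "0 \<le> err t y" for t y
    by (simp add: err_def)
  interpret step_gauge steps h e
  proof
    show "dominated steps e (\<lambda>_. 1)"
    proof (rule dominatedI[of 2])
      fix x assume x: "x \<in> steps"
      have "(h x)\<^sup>2 \<le> 1"
        using X(2,3)[OF x] by (simp add: power_le_one)
      then show "norm (e x) \<le> 2 * 1"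
        using X(5)[OF x] err_nonneg[of "\<tau> x" "z x"] by (simp add: e_def)
    qed simp
  qed (use X err_nonneg in \<open>auto simp: e_def\<close>)
  have I: "\<tau> x \<in> {t\<^sub>0..T}" "\<tau> x + h x \<in> {t\<^sub>0..T}" "\<tau> x + h x / 2 \<in> {t\<^sub>0..T}" if "x \<in> steps" for x
    using X(1,2,4)[OF that] by auto
  obtain KR where KR: "0 \<le> KR" "\<And>t. t \<in> {t\<^sub>0..T} \<Longrightarrow> norm (R t) \<le> KR"
    "\<And>t h. t\<^sub>0 \<le> t \<Longrightarrow> 0 \<le> h \<Longrightarrow> t + h \<le> T \<Longrightarrow>
       norm (R (t + h) - (R t + h *\<^sub>R rot (R t) (?s t))) \<le> KR * h\<^sup>2"
    "\<And>t h. t\<^sub>0 \<le> t \<Longrightarrow> 0 \<le> h \<Longrightarrow> t + h \<le> T \<Longrightarrow>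
       norm (R (t + h) - (R t + (h / 2) *\<^sub>R (rot (R t) (?s t) + rot (R (t + h)) (?s (t + h))))) \<le> KR * h ^ 3"
    by (rule C3_bounds[OF t\<^sub>0_less C3_R deriv_R]) blast+
  obtain K where K: "0 \<le> K" "\<And>t. t \<in> {t\<^sub>0..T} \<Longrightarrow> norm (\<omega> t) \<le> K" "\<And>t. t \<in> {t\<^sub>0..T} \<Longrightarrow> norm (\<omega>' t) \<le> K"
    "\<And>s t. s \<in> {t\<^sub>0..T} \<Longrightarrow> t \<in> {t\<^sub>0..T} \<Longrightarrow> norm (\<omega> s - \<omega> t) \<le> K * \<bar>s - t\<bar>"
    "\<And>t h. t\<^sub>0 \<le> t \<Longrightarrow> 0 \<le> h \<Longrightarrow> t + h \<le> T \<Longrightarrow>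
       norm (\<omega> (t + h) - (\<omega> t + h *\<^sub>R \<omega>' t)) \<le> K * h\<^sup>2"
    "\<And>t h. t\<^sub>0 \<le> t \<Longrightarrow> 0 \<le> h \<Longrightarrow> t + h \<le> T \<Longrightarrow>
       norm (\<omega> (t + h) - (\<omega> t + (h / 2) *\<^sub>R (\<omega>' t + \<omega>' (t + h)))) \<le> K * h ^ 3"
    by (rule C3_bounds[OF t\<^sub>0_less C3_\<omega> deriv_\<omega>]) blast+
  obtain Ks where Ks: "0 \<le> Ks" "\<And>t. t \<in> {t\<^sub>0..T} \<Longrightarrow> norm (?s t) \<le> Ks"
    "\<And>s t. s \<in> {t\<^sub>0..T} \<Longrightarrow> t \<in> {t\<^sub>0..T} \<Longrightarrow> norm (?s s - ?s t) \<le> Ks * \<bar>s - t\<bar>"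
    using estimate_bounds by blast

  define r where "r x = R (\<tau> x)" for x
  define r1 where "r1 x = R (\<tau> x + h x)" for x
  define s where "s x = ?s (\<tau> x)" for x
  define s1 where "s1 x = ?s (\<tau> x + h x)" for x
  define \<eta> where "\<eta> x = \<omega> (\<tau> x)" for x
  define \<eta>1 where "\<eta>1 x = \<omega> (\<tau> x + h x)" for x
  define \<eta>h where "\<eta>h x = \<omega> (\<tau> x + h x / 2)" for x
  define \<eta>' where "\<eta>' x = \<omega>' (\<tau> x)" for x
  define \<eta>1' where "\<eta>1' x = \<omega>' (\<tau> x + h x)" for x
  define P where "P x = fst (z x)" for x
  define w where "w x = snd (z x)" for x
  define P1 where "P1 x = fst (z' x)" for x
  define w1 where "w1 x = snd (z' x)" for x
  define wh where "wh x = half (\<tau> x) (h x) (z x)" for x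
  \<comment> \<open>Sign and halving are absorbed here: exp(-(h/2) skew(\<Omega> - \<omega>))
    becomes exp(h skew p), and -m (\<Omega> - \<omega>) x \<omega> becomes 2m p x \<omega>.\<close>
  define p where "p x = (- (1 / 2)) *\<^sub>R s x" for x
  define q where "q x = (- (1 / 2)) *\<^sub>R s1 x" for x
  define p' where "p' x = (- (1 / 2)) *\<^sub>R (\<Omega> (\<tau> x) - w x)" for x
  define q' where "q' x = (- (1 / 2)) *\<^sub>R (\<Omega> (\<tau> x + h x) - w1 x)" for x
  define a where "a x = (1 / 2) *\<^sub>R (\<Omega> (\<tau> x) + \<Omega> (\<tau> x + h x)) - \<eta>h x" for x
  define a' where "a' x = (1 / 2) *\<^sub>R (\<Omega> (\<tau> x) + \<Omega> (\<tau> x + h x)) - wh x" for x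
  define Fe where "Fe x = F (\<tau> x) (r x)" for x
  define Fe1 where "Fe1 x = F (\<tau> x + h x) (r1 x)" for x
  define Fn where "Fn x = F (\<tau> x) (P x)" for x
  define Fn1 where "Fn1 x = F (\<tau> x + h x) (P1 x)" for x

  have r: "BigO r (\<lambda>_. 1)" "BigO r1 (\<lambda>_. 1)"
    using KR(1) KR(2)[OF I(1)] KR(2)[OF I(2)] by (auto simp: r_def r1_def intro!: dominatedI[of KR])
  have s: "BigO s (\<lambda>_. 1)" "BigO s1 (\<lambda>_. 1)"
    using Ks(1) Ks(2)[OF I(1)] Ks(2)[OF I(2)] by (auto simp: s_def s1_def intro!: dominatedI[of Ks])
  have \<eta>: "BigO \<eta> (\<lambda>_. 1)" "BigO \<eta>1 (\<lambda>_. 1)" "BigO \<eta>h (\<lambda>_. 1)" "BigO \<eta>' (\<lambda>_. 1)"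
    using K(1) K(2)[OF I(1)] K(2)[OF I(2)] K(2)[OF I(3)] K(3)[OF I(1)]
    by (auto simp: \<eta>_def \<eta>1_def \<eta>h_def \<eta>'_def intro!: dominatedI[of K])
  have ds: "BigO (\<lambda>x. s1 x - s x) h"
  proof (rule dominatedI[OF Ks(1)])
    show "norm (s1 x - s x) \<le> Ks * h x" if "x \<in> steps" for x
      using Ks(3)[OF I(2) I(1), OF that that] X(2)[OF that] by (simp add: s_def s1_def)
  qed
  have d\<eta>: "BigO (\<lambda>x. \<eta>1 x - \<eta> x) h"
  proof (rule dominatedI[OF K(1)])
    show "norm (\<eta>1 x - \<eta> x) \<le> K * h x" if "x \<in> steps" for x
      using K(4)[OF I(2) I(1), OF that that] X(2)[OF that] by (simp add: \<eta>_def \<eta>1_def)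
  qed
  have mid: "BigO (\<lambda>x. \<eta>h x - (\<eta> x + (h x / 2) *\<^sub>R \<eta>' x)) (\<lambda>x. (h x)\<^sup>2)"
  proof (rule dominatedI[OF K(1)])
    fix x assume x: "x \<in> steps"
    have "norm (\<eta>h x - (\<eta> x + (h x / 2) *\<^sub>R \<eta>' x)) \<le> K * (h x / 2)\<^sup>2"
      using K(5)[of "\<tau> x" "h x / 2"] X(1,2,4)[OF x] by (simp add: \<eta>_def \<eta>h_def \<eta>'_def)
    also have "\<dots> \<le> K * (h x)\<^sup>2"
      using K(1) by (intro mult_left_mono) (auto simp: power_divide)
    finally show "norm (\<eta>h x - (\<eta> x + (h x / 2) *\<^sub>R \<eta>' x)) \<le> K * (h x)\<^sup>2" .
  qed
  have euler: "BigO (\<lambda>x. \<eta>1 x - (\<eta> x + h x *\<^sub>R \<eta>' x)) (\<lambda>x. (h x)\<^sup>2)"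
  proof (rule dominatedI[OF K(1)])
    show "norm (\<eta>1 x - (\<eta> x + h x *\<^sub>R \<eta>' x)) \<le> K * (h x)\<^sup>2" if "x \<in> steps" for x
      using K(5) X(1,2,4)[OF that] by (simp add: \<eta>_def \<eta>1_def \<eta>'_def)
  qed
  \<comment> \<open>The midpoint value and the mean of the end values share the linear expansion
    \<eta> + (h/2) \<eta>'.\<close>
  have mid': "BigO (\<lambda>x. \<eta>h x - (1 / 2) *\<^sub>R (\<eta> x + \<eta>1 x)) (\<lambda>x. (h x)\<^sup>2)"
  proof (rule dominated_cong)
    show "BigO (\<lambda>x. (\<eta>h x - (\<eta> x + (h x / 2) *\<^sub>R \<eta>' x)) - (1 / 2) *\<^sub>R (\<eta>1 x - (\<eta> x + h x *\<^sub>R \<eta>' x))) (\<lambda>x. (h x)\<^sup>2)"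
      by (intro dominated_diff mid dominated_scaleR euler)
  qed (simp only: vec_simps, simp add: field_simps)
  have trap: "BigO (\<lambda>x. \<eta>1 x - (\<eta> x + (h x / 2) *\<^sub>R (\<eta>' x + \<eta>1' x))) (\<lambda>x. h x ^ 3)"
  proof (rule dominatedI[OF K(1)])
    show "norm (\<eta>1 x - (\<eta> x + (h x / 2) *\<^sub>R (\<eta>' x + \<eta>1' x))) \<le> K * h x ^ 3" if "x \<in> steps" for x
      using K(6) X(1,2,4)[OF that] by (simp add: \<eta>_def \<eta>1_def \<eta>'_def \<eta>1'_def)
  qed
  have euler_r: "BigO (\<lambda>x. r1 x - (r x + h x *\<^sub>R rot (r x) (s x))) (\<lambda>x. (h x)\<^sup>2)"
  proof (rule dominatedI[OF KR(1)])
    show "norm (r1 x - (r x + h x *\<^sub>R rot (r x) (s x))) \<le> KR * (h x)\<^sup>2" if "x \<in> steps" for x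
      using KR(3) X(1,2,4)[OF that] by (simp add: r_def r1_def s_def)
  qed
  have trap_r: "BigO (\<lambda>x. r1 x - (r x + (h x / 2) *\<^sub>R (rot (r x) (s x) + rot (r1 x) (s1 x)))) (\<lambda>x. h x ^ 3)"
  proof (rule dominatedI[OF KR(1)])
    show "norm (r1 x - (r x + (h x / 2) *\<^sub>R (rot (r x) (s x) + rot (r1 x) (s1 x)))) \<le> KR * h x ^ 3"
      if "x \<in> steps" for x
      using KR(4) X(1,2,4)[OF that] by (simp add: r_def r1_def s_def s1_def)
  qed
  have ew: "BigO (\<lambda>x. w x - \<eta> x) e" and eP: "BigO (\<lambda>x. P x - r x) e"
    by (auto intro!: dominatedI[of 1] simp: e_def err_def P_def w_def r_def \<eta>_def)
  have w: "BigO w (\<lambda>_. 1)"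
    by (rule dominated_cong[OF dominated_add[OF O_e_1[OF ew] \<eta>(1)]]) simp
  have P: "BigO P (\<lambda>_. 1)"
    by (rule dominated_cong[OF dominated_add[OF O_e_1[OF eP] r(1)]]) simp
  have p: "BigO p (\<lambda>_. 1)" "BigO q (\<lambda>_. 1)"
    unfolding p_def q_def by (intro dominated_scaleR s)+
  have ep: "BigO (\<lambda>x. p' x - p x) e"
    by (rule dominated_cong[OF dominated_scaleR[OF ew, of "1 / 2"]])
      (simp add: p'_def p_def s_def \<eta>_def algebra_simps)
  have p': "BigO p' (\<lambda>_. 1)"
    by (rule dominated_cong[OF dominated_add[OF O_e_1[OF ep] p(1)]]) simp
  have Fe: "BigO Fe (\<lambda>_. 1)" "BigO Fe1 (\<lambda>_. 1)"
    unfolding Fe_def Fe1_def by (intro dominated_feedback I r; assumption)+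
  have eF: "BigO (\<lambda>x. Fn x - Fe x) e"
    unfolding Fn_def Fe_def by (intro dominated_feedback(2) I P r eP; assumption)
  have deriv: "m *\<^sub>R \<eta>' x = (2 * m) *\<^sub>R cross3 (p x) (\<eta> x) + Fe x - D *v \<eta> x" if "x \<in> steps" for x
    using ode[OF I(1)[OF that]]
    by (simp add: \<eta>'_def \<eta>_def p_def s_def Fe_def r_def cross_mult_left)
  have deriv1: "m *\<^sub>R \<eta>1' x = (2 * m) *\<^sub>R cross3 (q x) (\<eta>1 x) + Fe1 x - D *v \<eta>1 x" if "x \<in> steps" for x
    using ode[OF I(2)[OF that]]
    by (simp add: \<eta>1'_def \<eta>1_def q_def s1_def Fe1_def r1_def cross_mult_left)
  have skew_scale: "(- (c / 2)) *\<^sub>R skew b = c *\<^sub>R skew ((- (1 / 2)) *\<^sub>R b)" for c b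
    using linear_scale[OF bounded_linear.linear[OF bounded_linear_skew], of "- (1 / 2)" b] by simp
  have half: "m *\<^sub>R wh x + (h x / 2) *\<^sub>R (D *v wh x)
      = mat_exp (h x *\<^sub>R skew (p' x)) *v (m *\<^sub>R w x) + (h x / 2) *\<^sub>R Fn x" if "x \<in> steps" for x
    unfolding wh_def half_step_def case_prod_beta p'_def skew_scale[symmetric]
    using X(2)[OF that] m_pos D_nonneg
    by (subst matrix_inv_shift_mult) (auto simp: w_def Fn_def P_def)
  have ewh: "BigO (\<lambda>x. wh x - \<eta>h x) e"
    by (rule half_step_error[OF m_pos D_nonneg half deriv mid ew ep eF w \<eta>(1) \<eta>(4) p(1) p'])
  have wh: "BigO wh (\<lambda>_. 1)"
    by (rule dominated_cong[OF dominated_add[OF O_e_1[OF ewh] \<eta>(3)]]) simp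
  \<comment> \<open>The averaged \<open>\<Omega>\<close> occurs both in \<open>a\<close> and in the
    mean of \<open>s\<close> and \<open>s1\<close> and cancels, so only the midpoint error of
    \<open>\<omega>\<close> survives.\<close>
  have mid_a: "BigO (\<lambda>x. a x - (1 / 2) *\<^sub>R (s x + s1 x)) (\<lambda>x. (h x)\<^sup>2)"
    by (rule dominated_cong[OF dominated_uminus[OF mid']])
      (simp add: a_def s_def s1_def \<eta>_def \<eta>1_def algebra_simps)
  have ea: "BigO (\<lambda>x. a' x - a x) e"
    by (rule dominated_cong[OF dominated_uminus[OF ewh]]) (simp add: a_def a'_def)
  have a: "BigO a (\<lambda>_. 1)"
    by (rule dominated_cong[OF dominated_add[OF O_h_1[OF O_h2_h[OF mid_a]]
            dominated_scaleR[OF dominated_add[OF s], of "1 / 2"]]]) simp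
  have a': "BigO a' (\<lambda>_. 1)"
    by (rule dominated_cong[OF dominated_add[OF O_e_1[OF ea] a]]) simp
  have P1: "P1 x = P x ** mat_exp (h x *\<^sub>R skew (a' x))" if "x \<in> steps" for x
    using X(6)[OF that]
    by (simp add: filter_step_def case_prod_beta Let_def P1_def P_def a'_def wh_def)
  have attitude: "BigO (\<lambda>x. (P1 x - r1 x) - (P x - r x)) (\<lambda>x. h x * e x)"
    by (rule attitude_step[OF P1 exact_attitude[OF trap_r euler_r ds mid_a r(1) s a] eP ea r(1) P a a'])
  have e_nonneg: "0 \<le> e x" for x
    by (simp add: e_def err_nonneg)
  have eP1: "BigO (\<lambda>x. P1 x - r1 x) e"
  proof (rule dominated_cong)
    have "BigO (\<lambda>x. (P1 x - r1 x) - (P x - r x)) e"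
      by (rule O_le[OF attitude]) (use h_nonneg h_le e_nonneg in \<open>simp add: mult_left_le_one_le\<close>)
    then show "BigO (\<lambda>x. ((P1 x - r1 x) - (P x - r x)) + (P x - r x)) e"
      by (intro dominated_add eP)
  qed simp
  have P1_bounded: "BigO P1 (\<lambda>_. 1)"
    by (rule dominated_cong[OF dominated_add[OF O_e_1[OF eP1] r(2)]]) simp
  have eF1: "BigO (\<lambda>x. Fn1 x - Fe1 x) e"
    unfolding Fn1_def Fe1_def by (intro dominated_feedback(2) I P1_bounded r eP1; assumption)
  have Fn1: "BigO Fn1 (\<lambda>_. 1)"
    unfolding Fn1_def by (intro dominated_feedback I P1_bounded; assumption)
  let ?v = "\<lambda>x. m *\<^sub>R wh x - (h x / 2) *\<^sub>R (D *v wh x) + (h x / 2) *\<^sub>R Fn1 x"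
  have num: "m *\<^sub>R w1 x = mat_exp (h x *\<^sub>R skew (q' x)) *v ?v x" if "x \<in> steps" for x
  proof -
    have "(m *\<^sub>R mat 1 - (h x / 2) *\<^sub>R D) *v wh x = m *\<^sub>R wh x - (h x / 2) *\<^sub>R (D *v wh x)"
      by (simp add: matrix_vector_mult_diff_rdistrib scaleR_matrix_vector_assoc[symmetric])
    moreover have "m *\<^sub>R w1 x = mat_exp ((- (h x / 2)) *\<^sub>R skew (\<Omega> (\<tau> x + h x) - w1 x)) *v
        ((m *\<^sub>R mat 1 - (h x / 2) *\<^sub>R D) *v wh x + (h x / 2) *\<^sub>R Fn1 x)"
      using X(6)[OF that]
      by (simp add: filter_step_def case_prod_beta Let_def P1_def w1_def wh_def Fn1_def)
    ultimately show ?thesis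
      by (simp only: q'_def skew_scale)
  qed
  have h_half: "\<bar>h x / 2\<bar> \<le> 1" if "x \<in> steps" for x
    using abs_h_le_1[OF that] by simp
  have v: "BigO ?v (\<lambda>_. 1)"
    by (intro dominated_add dominated_diff dominated_scaleR wh O_scale_le dominated_matrix_vector Fn1 h_half)
  \<comment> \<open>The isometry gives |m w1| = |?v| for any solution of the implicit equation,
    without reference to its error; this makes the enlarged gauge bounded.\<close>
  have w1: "BigO w1 (\<lambda>_. 1)"
  proof -
    have "BigO (\<lambda>x. m *\<^sub>R w1 x) (\<lambda>_. 1)"
    proof -
      have "norm (m *\<^sub>R w1 x) = norm (?v x)" if "x \<in> steps" for x
      proof -
        have "h x *\<^sub>R skew (q' x) = skew (h x *\<^sub>R q' x)"
          by (rule linear_scale[OF bounded_linear.linear[OF bounded_linear_skew], symmetric])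
        then show ?thesis
          by (simp only: num[OF that] mat_exp_skew_norm)
      qed
      then show ?thesis
        using v unfolding dominated_def by simp
    qed
    from dominated_scaleR[OF this, of "1 / m"] show ?thesis
      using m_pos by simp
  qed
  \<comment> \<open>The exponent \<open>q'\<close> contains \<open>w1\<close>, so q' - q is not yet
    known to be O(e). With the unknown error added to the gauge the velocity estimate applies, at
    the price of that error on both sides.\<close>
  define e1 where "e1 x = e x + norm (w1 x - \<eta>1 x)" for x
  interpret e1: step_gauge steps h e1
  proof
    show "(h x)\<^sup>2 \<le> e1 x" if "x \<in> steps" for x
      using h2_le_e[OF that] by (simp add: e1_def add_increasing2)
    have "BigO (\<lambda>x. w1 x - \<eta>1 x) (\<lambda>_. 1)"
      by (intro dominated_diff w1 \<eta>)
    then have "BigO (\<lambda>x. norm (w1 x - \<eta>1 x)) (\<lambda>_. 1)"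
      by (simp add: dominated_def)
    then show "BigO e1 (\<lambda>_. 1)"
      unfolding e1_def[abs_def] by (intro dominated_add e_bounded)
  qed (use h_pos h_le in auto)
  have e1: "BigO f e1" if "BigO f e" for f :: "_ \<Rightarrow> real^3"
    by (rule O_le[OF that]) (simp add: e1_def)
  have ew1: "BigO (\<lambda>x. w1 x - \<eta>1 x) e1"
    using e_nonneg by (intro dominatedI[of 1]) (auto simp: e1_def)
  have eq: "BigO (\<lambda>x. q' x - q x) e1"
    by (rule dominated_cong[OF dominated_scaleR[OF ew1, of "1 / 2"]])
      (simp add: q'_def q_def s1_def \<eta>1_def algebra_simps)
  have q': "BigO q' (\<lambda>_. 1)"
    by (rule dominated_cong[OF dominated_add[OF e1.O_e_1[OF eq] p(2)]]) simp
  have dq: "BigO (\<lambda>x. q x - p x) h"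
    by (rule dominated_cong[OF dominated_scaleR[OF ds, of "- (1 / 2)"]])
      (simp add: p_def q_def algebra_simps)
  have velocity: "BigO (\<lambda>x. (w1 x - \<eta>1 x) - (w x - \<eta> x)) (\<lambda>x. h x * e1 x)"
    by (rule e1.velocity_step[OF m_pos half num
          exact_velocity[OF deriv deriv1 trap mid' dq d\<eta> p \<eta>(1,2)]
          e1[OF ew] e1[OF ep] eq e1[OF eF] e1[OF eF1] e1[OF ewh] w \<eta>(1) \<eta>(3) p(1) p' p(2) q' Fe])
  obtain C1 where C1: "0 \<le> C1" "\<And>x. x \<in> steps \<Longrightarrow> norm ((P1 x - r1 x) - (P x - r x)) \<le> C1 * (h x * e x)"
    using attitude by (rule dominatedE) blast
  obtain C2 where C2: "0 \<le> C2" "\<And>x. x \<in> steps \<Longrightarrow> norm ((w1 x - \<eta>1 x) - (w x - \<eta> x)) \<le> C2 * (h x * e1 x)"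
    using velocity by (rule dominatedE) blast
  obtain C3 where C3: "0 \<le> C3" "\<And>x. x \<in> steps \<Longrightarrow> norm (wh x - \<eta>h x) \<le> C3 * e x"
    using ewh by (rule dominatedE) blast
  show thesis
  proof (rule that[of "C1 + C2 + C3"])
    fix t k y y' assume mem: "(t, k, y, y') \<in> steps"
    let ?x = "(t, k, y, y')"
    have k: "0 < k"
      using mem by (simp add: steps_def)
    have e_le: "e ?x \<le> e1 ?x"
      by (simp add: e1_def)
    have e1_le: "e1 ?x \<le> err t y + k\<^sup>2 + err (t + k) y'"
      by (simp add: e1_def e_def err_def \<tau>_def h_def z_def z'_def w1_def \<eta>1_def)
    have "norm (P1 ?x - r1 ?x) \<le> norm (P ?x - r ?x) + C1 * (k * e ?x)"
      using C1(2)[OF mem] norm_triangle_sub[of "P1 ?x - r1 ?x" "P ?x - r ?x"] by (simp add: h_def)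
    moreover have "norm (w1 ?x - \<eta>1 ?x) \<le> norm (w ?x - \<eta> ?x) + C2 * (k * e1 ?x)"
      using C2(2)[OF mem] norm_triangle_sub[of "w1 ?x - \<eta>1 ?x" "w ?x - \<eta> ?x"] by (simp add: h_def)
    ultimately have "err (t + k) y' \<le> err t y + (C1 * (k * e ?x) + C2 * (k * e1 ?x))"
      by (simp add: err_def \<tau>_def h_def z_def z'_def w1_def w_def P1_def P_def r1_def r_def \<eta>1_def \<eta>_def)
    also have "C1 * (k * e ?x) + C2 * (k * e1 ?x) \<le> C1 * (k * e1 ?x) + C2 * (k * e1 ?x)"
      using C1(1) k e_le by (intro add_right_mono mult_left_mono) auto
    also have "\<dots> = (C1 + C2) * (k * e1 ?x)"
      by (simp add: distrib_right)
    also have "\<dots> \<le> (C1 + C2 + C3) * (k * (err t y + k\<^sup>2 + err (t + k) y'))"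
      using C1(1) C2(1) C3(1) k e1_le order_trans[OF e_nonneg e_le] by (intro mult_mono) auto
    finally show "err (t + k) y' \<le> err t y + (C1 + C2 + C3) * k * (err t y + k\<^sup>2 + err (t + k) y')"
      by (simp add: mult.assoc)
    have "norm (half t k y - \<omega> (t + k / 2)) \<le> C3 * e ?x"
      using C3(2)[OF mem] by (simp add: wh_def \<eta>h_def \<tau>_def h_def z_def)
    also have "\<dots> \<le> (C1 + C2 + C3) * e ?x"
      using C1(1) C2(1) e_nonneg by (intro mult_right_mono) auto
    finally show "norm (half t k y - \<omega> (t + k / 2)) \<le> (C1 + C2 + C3) * (err t y + k\<^sup>2)"
      by (simp add: e_def \<tau>_def h_def z_def)
  qed (use C1(1) C2(1) C3(1) in simp)
qed

lemma filter_convergence: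
  obtains K h\<^sub>0 where "0 < h\<^sub>0"
    "\<And>t h z'. t\<^sub>0 \<le> t \<Longrightarrow> t + h \<le> T \<Longrightarrow> 0 < h \<Longrightarrow> h \<le> h\<^sub>0 \<Longrightarrow> step t h (R t, \<omega> t) z' \<Longrightarrow>
       err (t + h) z' \<le> K * h ^ 3"
    "\<And>N h ys i. N > 0 \<Longrightarrow> h = (T - t\<^sub>0) / real N \<Longrightarrow> h \<le> h\<^sub>0 \<Longrightarrow>
       discrete_solution step t\<^sub>0 h N (R t\<^sub>0, \<omega> t\<^sub>0) ys \<Longrightarrow> i \<le> N \<Longrightarrow>
       err (t\<^sub>0 + real i * h) (ys i) \<le> K * h\<^sup>2"
    "\<And>N h ys i. N > 0 \<Longrightarrow> h = (T - t\<^sub>0) / real N \<Longrightarrow> h \<le> h\<^sub>0 \<Longrightarrow>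
       discrete_solution step t\<^sub>0 h N (R t\<^sub>0, \<omega> t\<^sub>0) ys \<Longrightarrow> i < N \<Longrightarrow>
       norm (half (t\<^sub>0 + real i * h) h (ys i) - \<omega> (t\<^sub>0 + real i * h + h / 2)) \<le> K * h\<^sup>2"
proof -
  obtain C where C0: "0 \<le> C" and step_err: "\<And>t h z z'. (t, h, z, z') \<in> steps \<Longrightarrow>
       err (t + h) z' \<le> err t z + C * h * (err t z + h\<^sup>2 + err (t + h) z')"
    and half_err: "\<And>t h z z'. (t, h, z, z') \<in> steps \<Longrightarrow>
       norm (half t h z - \<omega> (t + h / 2)) \<le> C * (err t z + h\<^sup>2)"
    using step_error by blast
  \<comment> \<open>For u = C h \<le> 1/2 the implicit inequality y \<le> x + u (x + h^2 + y) solves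
    to y \<le> (1 + 4u) x + 4u h^2, because 1 + u \<le> (1 - u)(1 + 4u) and u \<le> 4u (1 -
    u).\<close>
  define A where "A = 4 * C"
  define G where "G = exp (A * (T - t\<^sub>0)) * (T - t\<^sub>0) * A"
  \<comment> \<open>The three bounds serve membership in \<open>steps\<close>, the absorption
    condition C h \<le> 1/2, and G h^2 \<le> 1 for the bootstrap.\<close>
  define h\<^sub>0 where "h\<^sub>0 = min 1 (min (1 / (2 * C + 1)) (1 / (G + 1)))"
  have A0: "0 \<le> A" and G0: "0 \<le> G"
    using C0 t\<^sub>0_less by (simp_all add: A_def G_def)
  have h0: "0 < h\<^sub>0"
    using C0 G0 by (simp add: h\<^sub>0_def)
  have err_nonneg: "0 \<le> err t z" for t z
    by (simp add: err_def)
  have steps: "(t, h, z, z') \<in> steps"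
    if "t\<^sub>0 \<le> t" "t + h \<le> T" "0 < h" "h \<le> h\<^sub>0" "err t z \<le> 1" "step t h z z'" for t h z z'
    using that by (simp add: steps_def h\<^sub>0_def)
  have one: "err (t + h) z' \<le> (1 + A * h) * err t z + A * h ^ 3"
    if "t\<^sub>0 \<le> t" "t + h \<le> T" "0 < h" "h \<le> h\<^sub>0" "err t z \<le> 1" "step t h z z'" for t h z z'
  proof -
    let ?u = "C * h" and ?x = "err t z" and ?y = "err (t + h) z'"
    have "h \<le> 1 / (2 * C + 1)"
      using \<open>h \<le> h\<^sub>0\<close> by (simp add: h\<^sub>0_def)
    then have "h * (2 * C + 1) \<le> 1"
      using C0 by (simp add: pos_le_divide_eq)
    then have u: "0 \<le> ?u" "?u \<le> 1 / 2"
      using C0 \<open>0 < h\<close> by (simp_all add: algebra_simps)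
    have "?y \<le> ?x + ?u * (?x + h\<^sup>2 + ?y)"
      by (rule step_err[OF steps[OF that]])
    then have y: "(1 - ?u) * ?y \<le> (1 + ?u) * ?x + ?u * h\<^sup>2"
      by (simp add: algebra_simps)
    have "(1 + ?u) * ?x \<le> (1 - ?u) * ((1 + 4 * ?u) * ?x)"
    proof -
      have "0 \<le> ?u * (1 - 2 * ?u) * 2"
        using u by simp
      then have "1 + ?u \<le> (1 - ?u) * (1 + 4 * ?u)"
        by (simp add: algebra_simps)
      then show ?thesis
        using err_nonneg[of t z] by (simp only: mult.assoc[symmetric] mult_right_mono)
    qed
    moreover have "?u * h\<^sup>2 \<le> (1 - ?u) * (4 * ?u * h\<^sup>2)"
    proof -
      have "?u * 1 \<le> ?u * (4 * (1 - ?u))"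
        using u by (intro mult_left_mono) auto
      then have "?u \<le> (1 - ?u) * (4 * ?u)"
        by (simp add: mult_ac)
      then have "?u * h\<^sup>2 \<le> ((1 - ?u) * (4 * ?u)) * h\<^sup>2"
        by (intro mult_right_mono) auto
      then show ?thesis
        by (simp only: mult.assoc)
    qed
    ultimately have "(1 - ?u) * ?y \<le> (1 - ?u) * ((1 + 4 * ?u) * ?x + 4 * ?u * h\<^sup>2)"
      using y by (simp only: distrib_left)
    then have "?y \<le> (1 + 4 * ?u) * ?x + 4 * ?u * h\<^sup>2"
      using u by (simp only: mult_le_cancel_left_pos)
    then show ?thesis
      by (simp add: A_def power2_eq_square power3_eq_cube mult_ac)
  qed
  have err0: "err t (R t, \<omega> t) = 0" for t
    by (simp add: err_def)
  have Gh: "G * h\<^sup>2 \<le> 1" if "0 < h" "h \<le> h\<^sub>0" for h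
  proof -
    have h: "h \<le> 1" "h \<le> 1 / (G + 1)"
      using that by (simp_all add: h\<^sub>0_def)
    then have "h * (G + 1) \<le> 1"
      using G0 by (simp add: pos_le_divide_eq)
    then have "G * h \<le> 1"
      using that by (simp add: algebra_simps)
    moreover have "G * h\<^sup>2 \<le> G * h"
      using h G0 that by (intro mult_left_mono) (simp_all add: power2_eq_square mult_left_le_one_le)
    ultimately show ?thesis
      by linarith
  qed
  have global: "0 < h \<and> (\<forall>i\<le>N. err (t\<^sub>0 + real i * h) (ys i) \<le> G * h\<^sup>2)"
    if "N > 0" "h = (T - t\<^sub>0) / real N" "h \<le> h\<^sub>0" "discrete_solution step t\<^sub>0 h N (R t\<^sub>0, \<omega> t\<^sub>0) ys" for N h ys
  proof -
    have h: "0 < h" "real N * h = T - t\<^sub>0"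
      using that t\<^sub>0_less by simp_all
    have "err (t\<^sub>0 + real i * h) (ys i) \<le> G * h\<^sup>2" if "i \<le> N" for i
      unfolding G_def
    proof (rule discrete_solution_error[where step = step and y\<^sub>0 = "(R t\<^sub>0, \<omega> t\<^sub>0)"])
      show "exp (A * (T - t\<^sub>0)) * (T - t\<^sub>0) * A * h\<^sup>2 \<le> 1"
        using Gh[OF h(1) \<open>h \<le> h\<^sub>0\<close>] by (simp add: G_def)
    qed (use one h \<open>h \<le> h\<^sub>0\<close> A0 err0 that \<open>discrete_solution step t\<^sub>0 h N _ ys\<close> in auto)
    with h(1) show ?thesis
      by blast
  qed
  show thesis
  proof (rule that[of h\<^sub>0 "A + G + C * (G + 1)", OF h0])
    fix t h z' assume *: "t\<^sub>0 \<le> t" "t + h \<le> T" "0 < h" "h \<le> h\<^sub>0" "step t h (R t, \<omega> t) z'"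
    have "err (t + h) z' \<le> A * h ^ 3"
      using one[OF *(1-4) _ *(5)] by (simp add: err0)
    also have "\<dots> \<le> (A + G + C * (G + 1)) * h ^ 3"
      using G0 C0 *(3) by (intro mult_right_mono) auto
    finally show "err (t + h) z' \<le> (A + G + C * (G + 1)) * h ^ 3" .
  next
    fix N h ys i
    assume *: "0 < N" "h = (T - t\<^sub>0) / real N" "h \<le> h\<^sub>0" "discrete_solution step t\<^sub>0 h N (R t\<^sub>0, \<omega> t\<^sub>0) ys" "i \<le> N"
    have "err (t\<^sub>0 + real i * h) (ys i) \<le> G * h\<^sup>2"
      using global[OF *(1-4)] *(5) by blast
    also have "\<dots> \<le> (A + G + C * (G + 1)) * h\<^sup>2"
      using A0 G0 C0 by (intro mult_right_mono) auto
    finally show "err (t\<^sub>0 + real i * h) (ys i) \<le> (A + G + C * (G + 1)) * h\<^sup>2" .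
  next
    fix N h ys i
    assume *: "0 < N" "h = (T - t\<^sub>0) / real N" "h \<le> h\<^sub>0" "discrete_solution step t\<^sub>0 h N (R t\<^sub>0, \<omega> t\<^sub>0) ys" "i < N"
    let ?t = "t\<^sub>0 + real i * h"
    have h: "0 < h" and e: "err ?t (ys i) \<le> G * h\<^sup>2"
      using global[OF *(1-4)] *(5) by auto
    \<comment> \<open>The half-step estimate is indexed by complete steps, so i < N is used to see
      that step i ends inside the interval and belongs to \<open>steps\<close>.\<close>
    have "real (Suc i) * h \<le> real N * h"
      using *(5) h by (intro mult_right_mono) auto
    moreover have "real N * h = T - t\<^sub>0"
      using *(1,2) by simp
    ultimately have "?t + h \<le> T"
      by (simp add: distrib_right)
    moreover have "step ?t h (ys i) (ys (Suc i))"
      using *(4,5) by (simp add: discrete_solution_def)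
    moreover have "err ?t (ys i) \<le> 1"
      using e Gh[OF h *(3)] by linarith
    ultimately have "(?t, h, ys i, ys (Suc i)) \<in> steps"
      using h *(3) by (intro steps) auto
    from half_err[OF this] have "norm (half ?t h (ys i) - \<omega> (?t + h / 2)) \<le> C * (err ?t (ys i) + h\<^sup>2)" .
    also have "\<dots> \<le> C * (G * h\<^sup>2 + h\<^sup>2)"
      using e C0 by (intro mult_left_mono) auto
    also have "\<dots> = (C * (G + 1)) * h\<^sup>2"
      by (simp add: algebra_simps)
    also have "\<dots> \<le> (A + G + C * (G + 1)) * h\<^sup>2"
      using A0 G0 by (intro mult_right_mono) auto
    finally show "norm (half ?t h (ys i) - \<omega> (?t + h / 2)) \<le> (A + G + C * (G + 1)) * h\<^sup>2" .
  qed
qed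

lemma norm_diff_le_err: "norm (z - (R t, \<omega> t)) \<le> err t z"
  unfolding err_def using norm_triangle_ineq[of "(fst z - R t, 0)" "(0, snd z - \<omega> t)"]
  by (cases z) (simp add: norm_Pair)

end

lemma filter_solution_exact:
  assumes "t\<^sub>0 < T" "m > 0" "positive_definite D" "gain_function \<Phi> \<phi>"
    and "continuous_on {t\<^sub>0..T} E" "continuous_on {t\<^sub>0..T} W" "continuous_on {t\<^sub>0..T} U"
    and "\<forall>t\<in>{t\<^sub>0..T}. adapted_weight (E t) (W t)"
    and sol: "filter_solution m D \<phi> E W U \<Omega> t\<^sub>0 T y" and C3: "Cn_on 3 y {t\<^sub>0..T}"
  obtains R \<omega> \<omega>' where "y = (\<lambda>t. (R t, \<omega> t))" "exact_filter_solution m t\<^sub>0 T D \<phi> E U W \<Omega> R \<omega> \<omega>'"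
proof -
  obtain R \<omega> \<omega>' where y: "y = (\<lambda>t. (R t, \<omega> t))" and *: "\<forall>t\<in>{t\<^sub>0..T}.
      rotation_matrix (R t) \<and>
      (R has_vector_derivative R t ** skew (\<Omega> t - \<omega> t)) (at t within {t\<^sub>0..T}) \<and>
      (\<omega> has_vector_derivative \<omega>' t) (at t within {t\<^sub>0..T}) \<and>
      m *\<^sub>R \<omega>' t = - (m *\<^sub>R cross3 (\<Omega> t - \<omega> t) (\<omega> t)) + feedback \<phi> E W U t (R t) - D *v \<omega> t"
    using sol unfolding filter_solution_def by blast
  have "exact_filter_solution m t\<^sub>0 T D \<phi> E U W \<Omega> R \<omega> \<omega>'"
  proof
    show "0 \<le> v \<bullet> (D *v v)" for v
      using assms(3) by (cases "v = 0") (auto simp: positive_definite_def less_imp_le)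
    have W: "positive_definite (W t)" if "t \<in> {t\<^sub>0..T}" for t
      using assms(8) that by (simp add: adapted_weight_def)
    show "\<exists>C\<ge>0. \<forall>t\<in>{t\<^sub>0..T}. \<forall>P Q. norm P \<le> B \<longrightarrow> norm Q \<le> B \<longrightarrow>
        norm (feedback \<phi> E W U t P) \<le> C \<and>
        norm (feedback \<phi> E W U t P - feedback \<phi> E W U t Q) \<le> C * norm (P - Q)" if "0 \<le> B" for B
      by (rule feedback_bounds[OF assms(4-7) compact_Icc W that]) blast+
    show "Cn_on 3 R {t\<^sub>0..T}" "Cn_on 3 \<omega> {t\<^sub>0..T}"
      using Cn_on_bounded_linear[OF bounded_linear_fst C3] Cn_on_bounded_linear[OF bounded_linear_snd C3]
      by (simp_all add: y)
  qed (use assms(1,2) * in auto)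
  with y that show thesis
    by blast
qed

text \<open>The second conjunct makes precise the clause that the half-step value approximates the
  angular velocity at the middle of the step.\<close>

theorem proposition4p4:
  fixes m t\<^sub>0 T :: real
    and D :: "real^3^3"
    and \<Phi> \<phi> :: "real \<Rightarrow> real"
    and E U :: "real \<Rightarrow> real^'n^3"
    and W :: "real \<Rightarrow> real^'n^'n"
    and \<Omega> :: "real \<Rightarrow> real^3"
  assumes "t\<^sub>0 < T"
    and "m > 0"
    and "positive_definite D"
    and "gain_function \<Phi> \<phi>"
    and "continuous_on {t\<^sub>0..T} E" and "continuous_on {t\<^sub>0..T} W"
    and "continuous_on {t\<^sub>0..T} U" and "continuous_on {t\<^sub>0..T} \<Omega>"
    and "\<And>t. t \<in> {t\<^sub>0..T} \<Longrightarrow> rank (E t) = 3"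
    and "\<And>t. t \<in> {t\<^sub>0..T} \<Longrightarrow> adapted_weight (E t) (W t)"
  shows "integrator_of_order 2 (filter_solution m D \<phi> E W U \<Omega> t\<^sub>0 T)
           (filter_step m D \<phi> E W U \<Omega>) t\<^sub>0 T \<and>
         (\<forall>y. filter_solution m D \<phi> E W U \<Omega> t\<^sub>0 T y \<and> Cn_on 3 y {t\<^sub>0..T} \<longrightarrow>
           (\<exists>K h\<^sub>0. h\<^sub>0 > 0 \<and> (\<forall>N h ys. N > 0 \<and> h = (T - t\<^sub>0) / real N \<and> h \<le> h\<^sub>0 \<and>
             discrete_solution (filter_step m D \<phi> E W U \<Omega>) t\<^sub>0 h N (y t\<^sub>0) ys \<longrightarrow>
               (\<forall>i<N. norm (half_step m D \<phi> E W U \<Omega> (t\<^sub>0 + real i * h) h (ys i)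
                         - snd (y (t\<^sub>0 + real i * h + h / 2))) \<le> K * h ^ 2))))"
proof (intro conjI allI impI)
  have W: "\<forall>t\<in>{t\<^sub>0..T}. adapted_weight (E t) (W t)"
    using assms(10) by blast
  note ex = filter_step_solvable[OF \<open>m > 0\<close>, of D \<phi> E W U \<Omega>]
  show "integrator_of_order 2 (filter_solution m D \<phi> E W U \<Omega> t\<^sub>0 T) (filter_step m D \<phi> E W U \<Omega>) t\<^sub>0 T"
    unfolding integrator_of_order_def
  proof (intro allI impI, elim conjE)
    fix y assume sol: "filter_solution m D \<phi> E W U \<Omega> t\<^sub>0 T y" and C3: "Cn_on (2 + 1) y {t\<^sub>0..T}"
    have "Cn_on 3 y {t\<^sub>0..T}"
      using C3 by (simp only: numeral_plus_one add_num_simps semiring_norm)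
    with sol obtain R \<omega> \<omega>' where y: "y = (\<lambda>t. (R t, \<omega> t))"
      and "exact_filter_solution m t\<^sub>0 T D \<phi> E U W \<Omega> R \<omega> \<omega>'"
      by (rule filter_solution_exact[OF assms(1-7) W])
    then interpret exact_filter_solution m t\<^sub>0 T D \<phi> E U W \<Omega> R \<omega> \<omega>'
      by simp
    obtain K h\<^sub>0 where "0 < h\<^sub>0"
      and loc: "\<And>t h z'. t\<^sub>0 \<le> t \<Longrightarrow> t + h \<le> T \<Longrightarrow> 0 < h \<Longrightarrow> h \<le> h\<^sub>0 \<Longrightarrow> step t h (R t, \<omega> t) z' \<Longrightarrow>
        err (t + h) z' \<le> K * h ^ 3"
      and glob: "\<And>N h ys i. N > 0 \<Longrightarrow> h = (T - t\<^sub>0) / real N \<Longrightarrow> h \<le> h\<^sub>0 \<Longrightarrow>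
        discrete_solution step t\<^sub>0 h N (R t\<^sub>0, \<omega> t\<^sub>0) ys \<Longrightarrow> i \<le> N \<Longrightarrow>
        err (t\<^sub>0 + real i * h) (ys i) \<le> K * h\<^sup>2"
      using filter_convergence by metis
    show "\<exists>K h\<^sub>0. h\<^sub>0 > 0 \<and>
         (\<forall>t h. t\<^sub>0 \<le> t \<and> t + h \<le> T \<and> 0 < h \<and> h \<le> h\<^sub>0 \<longrightarrow>
            (\<exists>y'. step t h (y t) y') \<and>
            (\<forall>y'. step t h (y t) y' \<longrightarrow> norm (y' - y (t + h)) \<le> K * h ^ (2 + 1))) \<and>
         (\<forall>N h. N > 0 \<and> h = (T - t\<^sub>0) / real N \<and> h \<le> h\<^sub>0 \<longrightarrow>
            (\<exists>ys. discrete_solution step t\<^sub>0 h N (y t\<^sub>0) ys) \<and>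
            (\<forall>ys. discrete_solution step t\<^sub>0 h N (y t\<^sub>0) ys \<longrightarrow>
               (\<forall>i\<le>N. norm (ys i - y (t\<^sub>0 + real i * h)) \<le> K * h ^ 2)))"
    proof (rule exI[of _ K], rule exI[of _ h\<^sub>0], intro conjI allI impI; (elim conjE)?)
      show "norm (z' - y (t + h)) \<le> K * h ^ (2 + 1)"
        if "t\<^sub>0 \<le> t" "t + h \<le> T" "0 < h" "h \<le> h\<^sub>0" "step t h (y t) z'" for t h z'
        using order_trans[OF norm_diff_le_err loc[OF that(1-4)]] that(5) by (simp add: y)
      show "norm (ys i - y (t\<^sub>0 + real i * h)) \<le> K * h ^ 2"
        if "N > 0" "h = (T - t\<^sub>0) / real N" "h \<le> h\<^sub>0" "discrete_solution step t\<^sub>0 h N (y t\<^sub>0) ys" "i \<le> N"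
        for N h ys i
        using order_trans[OF norm_diff_le_err glob[OF that(1-3)]] that(4,5) by (simp add: y)
      show "\<exists>ys. discrete_solution step t\<^sub>0 h N (y t\<^sub>0) ys" for N h
        by (rule discrete_solution_exists) (rule ex)
    qed (rule \<open>0 < h\<^sub>0\<close> ex)+
  qed
  fix y assume "filter_solution m D \<phi> E W U \<Omega> t\<^sub>0 T y \<and> Cn_on 3 y {t\<^sub>0..T}"
  then have "filter_solution m D \<phi> E W U \<Omega> t\<^sub>0 T y" "Cn_on 3 y {t\<^sub>0..T}"
    by blast+
  then obtain R \<omega> \<omega>' where y: "y = (\<lambda>t. (R t, \<omega> t))"
    and "exact_filter_solution m t\<^sub>0 T D \<phi> E U W \<Omega> R \<omega> \<omega>'"
    by (rule filter_solution_exact[OF assms(1-7) W])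
  then interpret exact_filter_solution m t\<^sub>0 T D \<phi> E U W \<Omega> R \<omega> \<omega>'
    by simp
  obtain K h\<^sub>0 where "0 < h\<^sub>0"
    and "\<And>N h ys i. N > 0 \<Longrightarrow> h = (T - t\<^sub>0) / real N \<Longrightarrow> h \<le> h\<^sub>0 \<Longrightarrow>
       discrete_solution step t\<^sub>0 h N (R t\<^sub>0, \<omega> t\<^sub>0) ys \<Longrightarrow> i < N \<Longrightarrow>
       norm (half (t\<^sub>0 + real i * h) h (ys i) - \<omega> (t\<^sub>0 + real i * h + h / 2)) \<le> K * h\<^sup>2"
    using filter_convergence by metis
  then show "\<exists>K h\<^sub>0. h\<^sub>0 > 0 \<and> (\<forall>N h ys. N > 0 \<and> h = (T - t\<^sub>0) / real N \<and> h \<le> h\<^sub>0 \<and>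
      discrete_solution step t\<^sub>0 h N (y t\<^sub>0) ys \<longrightarrow>
        (\<forall>i<N. norm (half (t\<^sub>0 + real i * h) h (ys i)
                  - snd (y (t\<^sub>0 + real i * h + h / 2))) \<le> K * h ^ 2))"
    by - (rule exI[of _ K], rule exI[of _ h\<^sub>0], simp add: y)
qed

end
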